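(* Let $0 < \kappa < 1$, $\lambda = \sqrt{1-\kappa^2}$, and let $P_\kappa = \wp(\,\cdot\,; G_2, G_3)$ with $G_2 = 48(1 + 8\kappa^2)$ and $G_3 = 64(1 - 20\kappa^2 - 8\kappa^4)$. The period lattice of $P_\kappa$ is rectangular, generated by $2\Omega_\kappa$ and $2\Omega_\kappa'$ with $\Omega_\kappa > 0$ real and $\Omega_\kappa'$ purely imaginary with positive imaginary part. Then $$\Omega_\kappa' = {\rm i}\, \tfrac{1}{6\sqrt2}\, \pi \,_2F_1 (\tfrac{1}{3}, \tfrac{2}{3}; 1; \lambda^2).$$
   Context: $\wp(\,\cdot\,; g_2, g_3)$ denotes the Weierstrass elliptic function with invariants $g_2, g_3$; $\,_2F_1$ is the Gauss hypergeometric function. *)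

theory Defs
  imports "HOL-Analysis.Analysis"
begin

text \<open>Weierstrass invariants of the lattice generated by 2 w1 and 2 w2
  (w1, w2 half-periods):
  g2 = 60 * sum over nonzero lattice points w of w^(-4),
  g3 = 140 * sum over nonzero lattice points w of w^(-6).
  The Weierstrass function with invariants g2, g3 is the one attached to
  the lattice having these invariants, so "the period lattice of wp(.;G2,G3)
  is generated by 2 w1, 2 w2" means exactly that this lattice has invariants G2, G3.\<close>

definition lattice_g2 :: "complex \<Rightarrow> complex \<Rightarrow> complex" where
  "lattice_g2 w1 w2 = 60 * infsum (\<lambda>(m::int, n::int).
      1 / (2 * of_int m * w1 + 2 * of_int n * w2) ^ 4) (UNIV - {(0, 0)})"

definition lattice_g3 :: "complex \<Rightarrow> complex \<Rightarrow> complex" where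
  "lattice_g3 w1 w2 = 140 * infsum (\<lambda>(m::int, n::int).
      1 / (2 * of_int m * w1 + 2 * of_int n * w2) ^ 6) (UNIV - {(0, 0)})"

definition hyp2F1 :: "real \<Rightarrow> real \<Rightarrow> real \<Rightarrow> real \<Rightarrow> real" where
  "hyp2F1 a b c x = (\<Sum>n. pochhammer a n * pochhammer b n / (pochhammer c n * fact n) * x ^ n)"

end

theory Submission
  imports Defs "HOL-Complex_Analysis.Complex_Analysis" "HOL-Real_Asymp.Real_Asymp"
begin

text \<open>
  On the imaginary axis of a rectangular lattice, \<open>p(u) = - \<wp>(iu)\<close> is real, decreases
  from infinity to a critical value on \<open>(0, t]\<close>, where \<open>it\<close> is the half-period, and satisfies
  \<open>p'\<^sup>2 = 4 p\<^sup>3 - G\<^sub>2 p + G\<^sub>3\<close>. With \<open>x = \<lambda>\<^sup>2\<close> and \<open>p = 2 / c\<^sup>2 - 6\<close> this becomes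
  \<open>c'\<^sup>2 = 2 (1 - (3 c - 4 x c\<^sup>3)\<^sup>2)\<close>. Put \<open>3 c - 4 x c\<^sup>3 = sin \<theta>\<close>; since \<open>3 s - 4 s\<^sup>3\<close> triples the
  angle, \<open>\<surd>x c = sin (z/3)\<close> with \<open>sin z = \<surd>x sin \<theta>\<close>, and
  \<open>3 \<surd>2 du = (cos (z/3) / cos z) d\<theta> = F(1/3, 2/3; 1/2; x sin\<^sup>2 \<theta>) d\<theta>\<close>. Here \<open>\<theta>\<close> runs over
  \<open>[0, \<pi>/2]\<close>, and integrating the series termwise yields \<open>3 \<surd>2 t = (\<pi>/2) F(1/3, 2/3; 1; x)\<close>.

  A rectangular lattice with the given invariants exists by the intermediate value theorem: for the
  half-periods \<open>1, iy\<close> one has \<open>g\<^sub>2 > 0\<close>, the quantity \<open>g\<^sub>3 / g\<^sub>2\<^bsup>3/2\<^esup>\<close> changes sign under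
  \<open>y \<mapsto> 1/y\<close> and tends to \<open>1/\<surd>27\<close> as \<open>y\<close> tends to infinity, by the values of the zeta function
  at 4 and 6.
\<close>

section \<open>The Gauss hypergeometric function\<close>

definition hyp2F1_coeff :: "real \<Rightarrow> real \<Rightarrow> real \<Rightarrow> nat \<Rightarrow> real" where
  "hyp2F1_coeff a b c n = pochhammer a n * pochhammer b n / (pochhammer c n * fact n)"

lemma hyp2F1_altdef: "hyp2F1 a b c x = (\<Sum>n. hyp2F1_coeff a b c n * x ^ n)"
  by (simp add: hyp2F1_def hyp2F1_coeff_def)

lemma hyp2F1_0 [simp]: "hyp2F1 a b c 0 = 1"
  using powser_zero[of "hyp2F1_coeff a b c"] by (simp add: hyp2F1_altdef hyp2F1_coeff_def[of _ _ _ 0])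

lemma hyp2F1_coeff_Suc:
  "hyp2F1_coeff a b c (Suc n) = (a + n) * (b + n) / ((c + n) * (real n + 1)) * hyp2F1_coeff a b c n"
  by (simp add: hyp2F1_coeff_def pochhammer_Suc mult_ac add_ac)

lemma hyp2F1_coeff_recurrence:
  assumes "c \<notin> \<int>\<^sub>\<le>\<^sub>0"
  shows "(real n + 1) * (c + n) * hyp2F1_coeff a b c (Suc n) = (a + n) * (b + n) * hyp2F1_coeff a b c n"
proof -
  have "c + n \<noteq> 0" "real n + 1 \<noteq> 0" using assms plus_of_nat_eq_0_imp by force+
  thus ?thesis by (simp add: hyp2F1_coeff_Suc)
qed

lemma summable_norm_hyp2F1:
  assumes "\<bar>x\<bar> < 1"
  shows "summable (\<lambda>n. norm (hyp2F1_coeff a b c n * x ^ n))"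
proof -
  obtain r where r: "\<bar>x\<bar> < r" "r < 1" using assms dense by blast
  have "(\<lambda>n. \<bar>(a + n) * (b + n) / ((c + n) * (real n + 1)) * x\<bar>) \<longlonglongrightarrow> \<bar>1 * x\<bar>"
  proof (intro tendsto_intros)
    show "(\<lambda>n. (a + n) * (b + n) / ((c + n) * (real n + 1))) \<longlonglongrightarrow> 1" by real_asymp
  qed
  hence "\<forall>\<^sub>F n in sequentially. \<bar>(a + n) * (b + n) / ((c + n) * (real n + 1)) * x\<bar> < r"
    using r(1) by (intro order_tendstoD) auto
  then obtain N where ratio_le: "\<bar>(a + n) * (b + n) / ((c + n) * (real n + 1)) * x\<bar> \<le> r" if "n \<ge> N" for n
    unfolding eventually_sequentially by (meson less_imp_le)
  show ?thesis
  proof (rule summable_ratio_test[OF r(2)])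
    fix n assume "n \<ge> N"
    from mult_right_mono[OF ratio_le[OF this], of "\<bar>hyp2F1_coeff a b c n * x ^ n\<bar>"]
    show "norm (norm (hyp2F1_coeff a b c (Suc n) * x ^ Suc n))
        \<le> r * norm (norm (hyp2F1_coeff a b c n * x ^ n))"
      by (simp add: hyp2F1_coeff_Suc abs_mult mult_ac)
  qed
qed

definition hyp2F1_deriv :: "nat \<Rightarrow> real \<Rightarrow> real \<Rightarrow> real \<Rightarrow> real \<Rightarrow> real" where
  "hyp2F1_deriv k a b c x = (\<Sum>n. (diffs ^^ k) (hyp2F1_coeff a b c) n * x ^ n)"

lemma hyp2F1_deriv_0 [simp]: "hyp2F1_deriv 0 a b c = hyp2F1 a b c"
  by (simp add: fun_eq_iff hyp2F1_deriv_def hyp2F1_altdef)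

lemma summable_hyp2F1_deriv:
  "\<bar>x\<bar> < 1 \<Longrightarrow> summable (\<lambda>n. (diffs ^^ k) (hyp2F1_coeff a b c) n * x ^ n)"
proof (induction k arbitrary: x)
  case 0
  thus ?case using summable_norm_cancel[OF summable_norm_hyp2F1] by simp
next
  case (Suc k)
  thus ?case by (auto intro: termdiff_converges[where K = 1])
qed

lemma DERIV_hyp2F1_deriv:
  "\<bar>x\<bar> < 1 \<Longrightarrow> (hyp2F1_deriv k a b c has_real_derivative hyp2F1_deriv (Suc k) a b c x) (at x)"
  using termdiffs_strong'[where K = 1 and c = "(diffs ^^ k) (hyp2F1_coeff a b c)" and z = x]
  by (simp add: hyp2F1_deriv_def[abs_def] summable_hyp2F1_deriv)

lemma isCont_hyp2F1: "\<bar>x\<bar> < 1 \<Longrightarrow> isCont (hyp2F1 a b c) x"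
  using DERIV_isCont[OF DERIV_hyp2F1_deriv[of x 0]] by simp

lemma sums_of_nat_mult_power:
  fixes x :: "'a :: real_normed_field"
  assumes "(\<lambda>n. diffs f n * x ^ n) sums s"
  shows "(\<lambda>n. of_nat n * f n * x ^ n) sums (x * s)"
proof -
  have "(\<lambda>n. of_nat (Suc n) * f (Suc n) * x ^ Suc n) sums (x * s)"
    using sums_mult[OF assms, of x] by (simp add: diffs_def mult_ac)
  from sums_Suc[OF this] show ?thesis by simp
qed

theorem hyp2F1_ode:
  fixes a b c x :: real
  assumes c_notin: "c \<notin> \<int>\<^sub>\<le>\<^sub>0" and abs_x: "\<bar>x\<bar> < 1"
  shows "x * (1 - x) * hyp2F1_deriv 2 a b c x + (c - (a + b + 1) * x) * hyp2F1_deriv 1 a b c x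
    = a * b * hyp2F1 a b c x"
proof -
  define f where "f = hyp2F1_coeff a b c"
  let ?F = "hyp2F1_deriv 0 a b c x" and ?F' = "hyp2F1_deriv 1 a b c x" and ?F'' = "hyp2F1_deriv 2 a b c x"
  have sums: "(\<lambda>n. (diffs ^^ k) f n * x ^ n) sums hyp2F1_deriv k a b c x" for k
    unfolding hyp2F1_deriv_def f_def by (intro summable_sums summable_hyp2F1_deriv abs_x)
  have sums_F: "(\<lambda>n. f n * x ^ n) sums ?F" and sums_F': "(\<lambda>n. diffs f n * x ^ n) sums ?F'"
    and sums_F'': "(\<lambda>n. diffs (diffs f) n * x ^ n) sums ?F''"
    using sums[of 0] sums[of 1] sums[of 2] by (simp_all add: numeral_2_eq_2)
  have sums_xF'': "(\<lambda>n. real n * diffs f n * x ^ n) sums (x * ?F'')"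
    by (rule sums_of_nat_mult_power[OF sums_F''])
  also have "(\<lambda>n. real n * diffs f n * x ^ n) = (\<lambda>n. diffs (\<lambda>n. (real n - 1) * f n) n * x ^ n)"
    by (simp add: diffs_def mult_ac)
  finally have sums_xxF'': "(\<lambda>n. real n * ((real n - 1) * f n) * x ^ n) sums (x * (x * ?F''))"
    by (rule sums_of_nat_mult_power)
  have "(\<lambda>n. real n * diffs f n * x ^ n - real n * ((real n - 1) * f n) * x ^ n + c * (diffs f n * x ^ n)
        - (a + b + 1) * (real n * f n * x ^ n) - a * b * (f n * x ^ n))
      sums (x * ?F'' - x * (x * ?F'') + c * ?F' - (a + b + 1) * (x * ?F') - a * b * ?F)"
    by (intro sums_add sums_diff sums_mult sums_F sums_F' sums_xF'' sums_xxF'' sums_of_nat_mult_power[OF sums_F'])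
  moreover have "real n * diffs f n * x ^ n - real n * ((real n - 1) * f n) * x ^ n + c * (diffs f n * x ^ n)
        - (a + b + 1) * (real n * f n * x ^ n) - a * b * (f n * x ^ n)
      = ((real n + 1) * (c + n) * f (Suc n) - (a + n) * (b + n) * f n) * x ^ n" for n
    by (simp add: diffs_def algebra_simps)
  ultimately have "(\<lambda>_. 0) sums (x * ?F'' - x * (x * ?F'') + c * ?F' - (a + b + 1) * (x * ?F') - a * b * ?F)"
    by (simp only: f_def hyp2F1_coeff_recurrence[OF c_notin] diff_self mult_zero_left)
  hence "x * ?F'' - x * (x * ?F'') + c * ?F' - (a + b + 1) * (x * ?F') - a * b * ?F = 0"
    using sums_unique2 sums_zero by blast
  thus ?thesis by (simp add: algebra_simps)
qed

lemma harmonic_ode_zero: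
  fixes h h' :: "real \<Rightarrow> real" and m r :: real
  assumes DERIV_h: "\<And>z. \<bar>z\<bar> < r \<Longrightarrow> (h has_real_derivative h' z) (at z)"
    and DERIV_h': "\<And>z. \<bar>z\<bar> < r \<Longrightarrow> (h' has_real_derivative - m\<^sup>2 * h z) (at z)"
    and initial: "h 0 = 0" "h' 0 = 0" and abs_z: "\<bar>z\<bar> < r"
  shows "h z = 0"
proof -
  have const: "f z = f 0"
    if "\<And>z. \<bar>z\<bar> < r \<Longrightarrow> (f has_real_derivative 0) (at z)" "\<bar>z\<bar> < r" for f z
  proof -
    have "f constant_on {-r<..<r}"
      using that(1) by (intro has_field_derivative_0_imp_constant_on) auto
    thus ?thesis using that(2) by (auto simp: constant_on_def abs_less_iff)
  qed
  define energy where "energy z = (h' z)\<^sup>2 + m\<^sup>2 * (h z)\<^sup>2" for z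
  have "energy z = energy 0" if "\<bar>z\<bar> < r" for z
    using that unfolding energy_def
    by (intro const) (auto intro!: derivative_eq_intros DERIV_h DERIV_h')
  hence "h' z = 0" if "\<bar>z\<bar> < r" for z
    using that by (simp add: energy_def initial add_nonneg_eq_0_iff)
  hence "h z = h 0" using DERIV_h abs_z by (intro const) auto
  thus ?thesis by (simp add: initial)
qed

lemma sin_squared_less_1:
  fixes z :: real
  assumes "\<bar>z\<bar> < pi / 2"
  shows "(sin z)\<^sup>2 < 1"
proof -
  have "0 < cos z" using assms by (intro cos_gt_zero_pi) auto
  thus ?thesis using sin_cos_squared_add[of z] zero_less_power[of "cos z" 2] by linarith
qed

theorem hyp2F1_half_sin_squared:
  fixes a z :: real
  assumes "\<bar>z\<bar> < pi / 2"
  shows "hyp2F1 a (1 - a) (1/2) ((sin z)\<^sup>2) * cos z = cos ((2 * a - 1) * z)"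
proof -
  define m where "m = 2 * a - 1"
  define F where "F k z = hyp2F1_deriv k a (1 - a) (1/2) ((sin z)\<^sup>2)" for k z
  define h where "h z = F 0 z * cos z - cos (m * z)" for z
  define h' where "h' z = 2 * sin z * (cos z)\<^sup>2 * F 1 z - sin z * F 0 z + m * sin (m * z)" for z
  have DERIV_F: "(F k has_real_derivative F (Suc k) z * (2 * sin z * cos z)) (at z)" if "\<bar>z\<bar> < pi / 2" for k z
    unfolding F_def using sin_squared_less_1[OF that]
    by (intro DERIV_chain2[OF DERIV_hyp2F1_deriv]) (auto intro!: derivative_eq_intros)
  have "h z = 0"
  proof (rule harmonic_ode_zero[OF _ _ _ _ assms])
    fix z :: real assume abs_z: "\<bar>z\<bar> < pi / 2"
    show "(h has_real_derivative h' z) (at z)"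
      unfolding h_def h'_def
      by (rule derivative_eq_intros DERIV_F abs_z refl)+ (simp add: algebra_simps power2_eq_square)
    have "(1/2 :: real) \<notin> \<int>\<^sub>\<le>\<^sub>0" by (auto elim!: nonpos_Ints_cases)
    from hyp2F1_ode[OF this, of "(sin z)\<^sup>2" a "1 - a"] sin_squared_less_1[OF abs_z]
    have ode: "(sin z)\<^sup>2 * (1 - (sin z)\<^sup>2) * F 2 z + (1/2 - 2 * (sin z)\<^sup>2) * F 1 z = a * (1 - a) * F 0 z"
      by (simp add: F_def)
    have "(h' has_real_derivative
        4 * cos z * ((sin z)\<^sup>2 * (cos z)\<^sup>2 * F 2 z + ((cos z)\<^sup>2 / 2 - 3/2 * (sin z)\<^sup>2) * F 1 z)
          - cos z * F 0 z + m\<^sup>2 * cos (m * z)) (at z)"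
      unfolding h'_def
      by (rule derivative_eq_intros DERIV_F abs_z refl)+
         (simp add: field_simps power2_eq_square flip: numeral_2_eq_2)
    also have "4 * cos z * ((sin z)\<^sup>2 * (cos z)\<^sup>2 * F 2 z + ((cos z)\<^sup>2 / 2 - 3/2 * (sin z)\<^sup>2) * F 1 z)
        = 4 * cos z * (a * (1 - a) * F 0 z)"
      unfolding ode[symmetric] cos_squared_eq by (simp add: field_simps)
    finally show "(h' has_real_derivative - m\<^sup>2 * h z) (at z)"
      by (simp add: h_def m_def algebra_simps power2_eq_square)
  qed (simp_all add: h_def h'_def F_def)
  thus ?thesis by (simp add: h_def F_def m_def)
qed

lemma has_integral_sin_even_power:
  "((\<lambda>\<theta>. sin \<theta> ^ (2 * n)) has_integral pi / 2 * (pochhammer (1/2) n / fact n)) {0..pi / 2}"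
proof (induction n)
  case 0
  show ?case using has_integral_const_real[of "1::real" 0 "pi/2"] by simp
next
  case (Suc n)
  let ?G = "\<lambda>\<theta>::real. sin \<theta> ^ (2 * n + 1) * cos \<theta>"
  have "((\<lambda>\<theta>. (2 * n + 1) * sin \<theta> ^ (2 * n) - (2 * n + 2) * sin \<theta> ^ (2 * Suc n)) has_integral
      (?G (pi/2) - ?G 0)) {0..pi/2}"
  proof (rule fundamental_theorem_of_calculus)
    fix \<theta> :: real
    have "(?G has_real_derivative
        (2 * n + 1) * sin \<theta> ^ (2 * n) * (cos \<theta>)\<^sup>2 - sin \<theta> ^ (2 * n + 1) * sin \<theta>) (at \<theta>)"
      by (rule derivative_eq_intros refl)+ (simp add: power2_eq_square)
    also have "(2 * n + 1) * sin \<theta> ^ (2 * n) * (cos \<theta>)\<^sup>2 - sin \<theta> ^ (2 * n + 1) * sin \<theta>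
        = (2 * n + 1) * sin \<theta> ^ (2 * n) - (2 * n + 2) * sin \<theta> ^ (2 * Suc n)"
      by (simp only: cos_squared_eq) (simp add: algebra_simps power2_eq_square)
    finally show "(?G has_vector_derivative
        (2 * n + 1) * sin \<theta> ^ (2 * n) - (2 * n + 2) * sin \<theta> ^ (2 * Suc n)) (at \<theta> within {0..pi/2})"
      unfolding has_real_derivative_iff_has_vector_derivative[symmetric]
      by (rule has_field_derivative_at_within)
  qed simp
  from has_integral_diff[OF has_integral_mult_right[OF Suc, of "2 * n + 1"] this]
  have "((\<lambda>\<theta>. (2 * n + 2) * sin \<theta> ^ (2 * Suc n)) has_integral
      (2 * n + 1) * (pi / 2 * (pochhammer (1/2) n / fact n))) {0..pi/2}"
    by (simp add: algebra_simps)
  from has_integral_divide[OF this, of "2 * n + 2"]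
  have "((\<lambda>\<theta>. sin \<theta> ^ (2 * Suc n)) has_integral
      (2 * n + 1) * (pi / 2 * (pochhammer (1/2) n / fact n)) / (2 * n + 2)) {0..pi/2}"
    by (simp only: nonzero_mult_div_cancel_left)
  also have "(2 * n + 1) * (pi / 2 * (pochhammer (1/2) n / fact n)) / (2 * n + 2)
      = pi / 2 * (pochhammer (1/2) (Suc n) / fact (Suc n))"
    by (simp add: pochhammer_Suc divide_simps)
  finally show ?case .
qed

lemma has_integral_suminf:
  fixes f :: "nat \<Rightarrow> 'a::euclidean_space \<Rightarrow> 'b::banach"
  assumes has_integral_f: "\<And>n. (f n has_integral I n) (cbox a b)" and continuous_f: "\<And>n. continuous_on (cbox a b) (f n)"
    and norm_le: "\<And>n x. x \<in> cbox a b \<Longrightarrow> norm (f n x) \<le> M n" and summable_M: "summable M"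
  shows "((\<lambda>x. \<Sum>n. f n x) has_integral (\<Sum>n. I n)) (cbox a b)"
proof -
  have "uniform_limit (cbox a b) (\<lambda>n x. \<Sum>i<n. f i x) (\<lambda>x. \<Sum>i. f i x) sequentially"
    using norm_le summable_M by (rule Weierstrass_m_test)
  then obtain J K where partial_integral: "\<And>n. ((\<lambda>x. \<Sum>i<n. f i x) has_integral J n) (cbox a b)"
    and limit_integral: "((\<lambda>x. \<Sum>i. f i x) has_integral K) (cbox a b)" "J \<longlonglongrightarrow> K"
    by (rule uniform_limit_integral_cbox) (auto intro: continuous_intros continuous_f)
  have "J n = (\<Sum>i<n. I i)" for n
    using partial_integral by (rule has_integral_unique) (intro has_integral_sum has_integral_f finite_lessThan)
  hence "J = (\<lambda>n. \<Sum>i<n. I i)" by blast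
  with limit_integral(2) have "I sums K" by (simp add: sums_def)
  thus ?thesis using limit_integral(1) by (simp add: sums_iff)
qed

theorem has_integral_hyp2F1_half:
  fixes a b x :: real
  assumes abs_x: "\<bar>x\<bar> < 1"
  shows "((\<lambda>\<theta>. hyp2F1 a b (1/2) (x * (sin \<theta>)\<^sup>2)) has_integral pi / 2 * hyp2F1 a b 1 x) {0..pi / 2}"
proof -
  let ?c = "hyp2F1_coeff a b (1/2)" and ?d = "hyp2F1_coeff a b 1"
  have coeff: "?c n * (pochhammer (1/2) n / fact n) = ?d n" for n
    using pochhammer_pos[of "1/2 :: real" n] by (simp add: hyp2F1_coeff_def pochhammer_fact)
  have "((\<lambda>\<theta>. \<Sum>n. ?c n * (x * (sin \<theta>)\<^sup>2) ^ n) has_integral (\<Sum>n. pi / 2 * (?d n * x ^ n))) (cbox 0 (pi/2))"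
  proof (rule has_integral_suminf[OF _ _ _ summable_norm_hyp2F1[OF abs_x]])
    show "((\<lambda>\<theta>. ?c n * (x * (sin \<theta>)\<^sup>2) ^ n) has_integral pi / 2 * (?d n * x ^ n)) (cbox 0 (pi/2))" for n
      using has_integral_mult_right[OF has_integral_sin_even_power, of "?c n * x ^ n" n]
      by (simp add: power_mult_distrib mult_ac flip: power_mult coeff)
    fix n and \<theta> :: real
    have "\<bar>sin \<theta>\<bar> ^ (2 * n) \<le> 1" by (rule power_le_one) auto
    thus "norm (?c n * (x * (sin \<theta>)\<^sup>2) ^ n) \<le> norm (?c n * x ^ n)"
      by (simp add: abs_mult power_abs power_mult_distrib mult_left_le flip: power_mult mult.assoc)
  qed (intro continuous_intros)
  also have "(\<Sum>n. pi / 2 * (?d n * x ^ n)) = pi / 2 * hyp2F1 a b 1 x"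
    unfolding hyp2F1_altdef by (rule suminf_mult[OF summable_norm_cancel[OF summable_norm_hyp2F1[OF abs_x]]])
  finally show ?thesis by (simp only: hyp2F1_altdef cbox_interval)
qed

section \<open>Trisection and the half-period\<close>

definition trisection_cubic :: "real \<Rightarrow> real \<Rightarrow> real" where
  "trisection_cubic x c = 3 * c - 4 * x * c ^ 3"

lemma trisection_cubic_0 [simp]: "trisection_cubic x 0 = 0"
  by (simp add: trisection_cubic_def)

lemma trisection_cubic_scale:
  assumes "0 \<le> x"
  shows "trisection_cubic 1 (sqrt x * c) = sqrt x * trisection_cubic x c"
  using assms by (simp add: trisection_cubic_def algebra_simps power3_eq_cube)

lemma trisection_cubic_strict_mono:
  fixes x c d :: real
  assumes x_pos: "0 < x" and "0 \<le> c" "c < d" and d_le: "4 * x * d\<^sup>2 \<le> 1"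
  shows "trisection_cubic x c < trisection_cubic x d"
proof -
  have "c * c + c * d + d * d < d * d + d * d + d * d"
    using assms(2,3) by (intro add_strict_right_mono add_less_le_mono mult_strict_mono) auto
  hence "4 * x * (c * c + c * d + d * d) < 4 * x * (3 * d\<^sup>2)"
    using x_pos by (intro mult_strict_left_mono) (auto simp: power2_eq_square)
  also have "\<dots> \<le> 3" using d_le by simp
  finally have "0 < (d - c) * (3 - 4 * x * (c * c + c * d + d * d))"
    using assms(3) by (intro mult_pos_pos) auto
  also have "\<dots> = trisection_cubic x d - trisection_cubic x c"
    by (simp add: trisection_cubic_def algebra_simps power3_eq_cube)
  finally show ?thesis by simp
qed

lemma sin_treble_sin: "sin (3 * z) = trisection_cubic 1 (sin z)"
proof -
  have "sin (3 * z) = sin (2 * z + z)" by simp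
  also have "\<dots> = 2 * sin z * (cos z)\<^sup>2 + (1 - 2 * (sin z)\<^sup>2) * sin z"
    by (simp only: sin_add sin_double cos_double_sin) (simp add: power2_eq_square)
  also have "\<dots> = trisection_cubic 1 (sin z)"
    by (simp only: cos_squared_eq)
       (simp add: trisection_cubic_def algebra_simps power2_eq_square power3_eq_cube)
  finally show ?thesis .
qed

lemma hyp2F1_trisection:
  assumes "0 \<le> s" "s < 1/2"
  shows "hyp2F1 (1/3) (2/3) (1/2) ((trisection_cubic 1 s)\<^sup>2) = 1 / (1 - 4 * s\<^sup>2)"
proof -
  define \<phi> where "\<phi> = arcsin s"
  have sin_\<phi>: "sin \<phi> = s" using assms by (simp add: \<phi>_def)
  have "arcsin s < arcsin (1/2)" using assms by (intro arcsin_less_arcsin) auto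
  also have "arcsin (1/2::real) = pi / 6" using arcsin_sin[of "pi/6"] by (simp add: sin_30)
  finally have \<phi>_range: "0 \<le> \<phi>" "\<phi> < pi / 6"
    using assms arcsin_le_arcsin[of 0 s] by (simp_all add: \<phi>_def)
  have cos_\<phi>_pos: "0 < cos \<phi>" using \<phi>_range by (intro cos_gt_zero_pi) auto
  have "cos (3 * \<phi>) = cos \<phi> * (4 * (cos \<phi>)\<^sup>2 - 3)"
    unfolding cos_treble_cos by (simp add: power3_eq_cube power2_eq_square algebra_simps)
  also have "4 * (cos \<phi>)\<^sup>2 - 3 = 1 - 4 * s\<^sup>2" by (simp add: cos_squared_eq sin_\<phi>)
  finally have cos_3\<phi>: "cos (3 * \<phi>) = cos \<phi> * (1 - 4 * s\<^sup>2)" .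
  have "hyp2F1 (1/3) (2/3) (1/2) ((sin (3 * \<phi>))\<^sup>2) * cos (3 * \<phi>) = cos \<phi>"
    using hyp2F1_half_sin_squared[of "3 * \<phi>" "1/3"] \<phi>_range by simp
  hence "hyp2F1 (1/3) (2/3) (1/2) ((trisection_cubic 1 s)\<^sup>2) * (1 - 4 * s\<^sup>2) = 1"
    using cos_\<phi>_pos by (simp add: sin_treble_sin sin_\<phi> cos_3\<phi>)
  thus ?thesis by (metis mult_zero_right nonzero_eq_divide_eq zero_neq_one)
qed

definition trisection_root :: "real \<Rightarrow> real" where
  "trisection_root x = sin (arcsin (sqrt x) / 3) / sqrt x"

lemma trisection_root:
  assumes x_bounds: "0 < x" "x < 1"
  shows trisection_root_pos: "0 < trisection_root x"
    and trisection_root_upper: "4 * x * (trisection_root x)\<^sup>2 < 1"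
    and trisection_cubic_root: "trisection_cubic x (trisection_root x) = 1"
proof -
  define s where "s = sin (arcsin (sqrt x) / 3)"
  have root: "trisection_root x = s / sqrt x" by (simp add: trisection_root_def s_def)
  have sqrt_x: "0 < sqrt x" "sqrt x < 1" "- 1 \<le> sqrt x"
    using x_bounds real_sqrt_ge_zero[of x] by (simp, simp, linarith)
  hence angle: "0 < arcsin (sqrt x)" "arcsin (sqrt x) < pi / 2"
    using arcsin_less_arcsin[of 0 "sqrt x"] arcsin_less_arcsin[of "sqrt x" 1] by simp_all
  have s_pos: "0 < s" unfolding s_def using angle by (intro sin_gt_zero) auto
  thus "0 < trisection_root x" using x_bounds by (simp add: root)
  have "s < sin (pi / 6)" unfolding s_def using angle by (intro sin_monotone_2pi) auto
  hence "s\<^sup>2 < (1/2)\<^sup>2" using s_pos by (intro power_strict_mono) (auto simp: sin_30)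
  thus "4 * x * (trisection_root x)\<^sup>2 < 1"
    using x_bounds by (simp add: root power_divide power2_eq_square)
  have "trisection_cubic 1 s = sqrt x"
    using sin_treble_sin[of "arcsin (sqrt x) / 3"] sqrt_x by (simp add: s_def)
  thus "trisection_cubic x (trisection_root x) = 1"
    using trisection_cubic_scale[of x "trisection_root x"] x_bounds by (simp add: root)
qed

lemma trisection_cubic_in_unit_interval:
  assumes "0 < x" "x < 1" "0 \<le> c" "c \<le> trisection_root x"
  shows "trisection_cubic x c \<in> {0..1}"
proof -
  note root = trisection_root[OF assms(1,2)]
  have mono: "trisection_cubic x c \<le> trisection_cubic x d"
    if "0 \<le> c" "c \<le> d" "d \<le> trisection_root x" for c d
  proof (cases "c = d")
    case False
    have "4 * x * d\<^sup>2 \<le> 4 * x * (trisection_root x)\<^sup>2"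
      using that assms(1) by (intro mult_left_mono power_mono) auto
    hence "4 * x * d\<^sup>2 \<le> 1" using root(2) by linarith
    with that False assms(1) show ?thesis
      by (intro less_imp_le[OF trisection_cubic_strict_mono]) auto
  qed simp
  show ?thesis using mono[of 0 c] mono[of c "trisection_root x"] assms root by auto
qed

lemma trisection_root_less_half:
  assumes "0 < x" "x < 1"
  shows "trisection_root x < 1/2"
proof -
  let ?d = "trisection_root x"
  note root = trisection_root[OF assms]
  have "4 * x * ?d\<^sup>2 * ?d < 1 * ?d" using root by (intro mult_strict_right_mono)
  moreover have "4 * x * ?d ^ 3 = 4 * x * ?d\<^sup>2 * ?d" by (simp add: power2_eq_square power3_eq_cube)
  ultimately show ?thesis using root(3) unfolding trisection_cubic_def by linarith
qed

text \<open>The cubic of \<open>- \<wp>\<close>, whose sign at \<open>g\<^sub>3\<close> differs from that of \<open>\<wp>\<close>.\<close>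

definition weierstrass_cubic :: "real \<Rightarrow> real \<Rightarrow> real \<Rightarrow> real" where
  "weierstrass_cubic g2 g3 y = 4 * y ^ 3 - g2 * y + g3"

text \<open>The invariants \<open>G\<^sub>2\<close> and \<open>G\<^sub>3\<close> as functions of \<open>x = 1 - \<kappa>\<^sup>2\<close>.\<close>

definition trisection_g2 :: "real \<Rightarrow> real" where
  "trisection_g2 x = 48 * (9 - 8 * x)"

definition trisection_g3 :: "real \<Rightarrow> real" where
  "trisection_g3 x = 64 * (36 * x - 27 - 8 * x\<^sup>2)"

lemma weierstrass_cubic_trisection:
  assumes "c \<noteq> 0"
  shows "weierstrass_cubic (trisection_g2 x) (trisection_g3 x) (2 / c\<^sup>2 - 6)
    = 32 / c ^ 6 * (1 - (trisection_cubic x c)\<^sup>2)"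
proof -
  define i where "i = 1 / c"
  have c_i: "c ^ 3 * i ^ 3 = 1" "c * i ^ 3 = i\<^sup>2"
    using assms by (simp_all add: i_def power_divide power3_eq_cube power2_eq_square)
  have "trisection_cubic x c * i ^ 3 = 3 * (c * i ^ 3) - 4 * x * (c ^ 3 * i ^ 3)"
    by (simp add: trisection_cubic_def algebra_simps)
  also have "\<dots> = 3 * i\<^sup>2 - 4 * x" by (simp add: c_i)
  finally have cubic_i: "trisection_cubic x c * i ^ 3 = 3 * i\<^sup>2 - 4 * x" .
  have "32 / c ^ 6 * (1 - (trisection_cubic x c)\<^sup>2) = 32 * (i ^ 6 - (trisection_cubic x c * i ^ 3)\<^sup>2)"
    by (simp add: i_def right_diff_distrib power_mult_distrib power_divide flip: power_mult)
  also have "\<dots> = weierstrass_cubic (trisection_g2 x) (trisection_g3 x) (2 * i\<^sup>2 - 6)"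
    unfolding cubic_i weierstrass_cubic_def trisection_g2_def trisection_g3_def
    by (simp add: power_numeral_reduce algebra_simps)
  finally show ?thesis by (simp add: i_def power_divide)
qed

lemma trisection_root_weierstrass:
  assumes x_bounds: "0 < x" "x < 1"
  defines "r \<equiv> 2 / (trisection_root x)\<^sup>2 - 6"
  shows "weierstrass_cubic (trisection_g2 x) (trisection_g3 x) r = 0"
    and "0 < r" and "trisection_g2 x < 12 * r\<^sup>2"
proof -
  define d where "d = trisection_root x"
  have d_root: "0 < d" "d < 1/2" "trisection_cubic x d = 1"
    using trisection_root[OF x_bounds] trisection_root_less_half[OF x_bounds] by (simp_all add: d_def)
  have r_eq: "r = 2 / d\<^sup>2 - 6" by (simp add: r_def d_def)
  show "weierstrass_cubic (trisection_g2 x) (trisection_g3 x) r = 0"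
    unfolding r_eq using weierstrass_cubic_trisection[of d x] d_root by simp
  have "d\<^sup>2 < (1/2)\<^sup>2" using d_root by (intro power_strict_mono) auto
  hence "2 / (1/2)\<^sup>2 < 2 / d\<^sup>2" using d_root by (intro divide_strict_left_mono) auto
  thus "0 < r" by (simp add: r_eq power2_eq_square)
  define i where "i = 1 / d"
  have d_inverse: "d ^ 3 * i ^ 3 = 1" "d * i ^ 3 = i\<^sup>2" "2 < i"
    using d_root by (simp_all add: i_def field_simps power3_eq_cube power2_eq_square)
  have "4 * x = 4 * x * d ^ 3 * i ^ 3" by (simp only: d_inverse mult.assoc mult_1_right)
  also have "4 * x * d ^ 3 = 3 * d - 1" using d_root(3) by (simp add: trisection_cubic_def)
  also have "(3 * d - 1) * i ^ 3 = 3 * i\<^sup>2 - i ^ 3" by (simp add: left_diff_distrib d_inverse)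
  finally have "8 * x = 6 * i\<^sup>2 - 2 * i ^ 3" by simp
  moreover have "r = 2 * i\<^sup>2 - 6" by (simp add: r_eq i_def power_divide)
  ultimately have "12 * r\<^sup>2 - trisection_g2 x = 48 * i ^ 3 * (i - 2)"
    by (simp only: trisection_g2_def) (simp add: algebra_simps power_numeral_reduce)
  moreover have "0 < 48 * i ^ 3 * (i - 2)" using d_inverse by simp
  ultimately show "trisection_g2 x < 12 * r\<^sup>2" by linarith
qed

locale weierstrass_real_branch =
  fixes p p' :: "real \<Rightarrow> real" and g2 g3 r t :: real
  assumes t_pos: "0 < t"
    and DERIV_p: "\<And>u. 0 < u \<Longrightarrow> u \<le> t \<Longrightarrow> (p has_real_derivative p' u) (at u)"
    and DERIV_p': "\<And>u. 0 < u \<Longrightarrow> u \<le> t \<Longrightarrow> (p' has_real_derivative 6 * (p u)\<^sup>2 - g2 / 2) (at u)"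
    and ode: "\<And>u. 0 < u \<Longrightarrow> u \<le> t \<Longrightarrow> (p' u)\<^sup>2 = weierstrass_cubic g2 g3 (p u)"
    and p_at_0: "filterlim p at_top (at_right 0)"
    and p'_end: "p' t = 0"
    and root: "weierstrass_cubic g2 g3 r = 0"
    and root_pos: "0 < r" and root_lower: "g2 < 12 * r\<^sup>2"
begin

lemma weierstrass_cubic_factor:
  "weierstrass_cubic g2 g3 y = (y - r) * (4 * (y\<^sup>2 + y * r + r\<^sup>2) - g2)"
proof -
  have "weierstrass_cubic g2 g3 y = weierstrass_cubic g2 g3 y - weierstrass_cubic g2 g3 r"
    by (simp only: root diff_zero)
  also have "\<dots> = (y - r) * (4 * (y\<^sup>2 + y * r + r\<^sup>2) - g2)"
    by (simp add: weierstrass_cubic_def algebra_simps power2_eq_square power3_eq_cube)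
  finally show ?thesis .
qed

lemma weierstrass_cubic_pos:
  assumes "r < y"
  shows "0 < weierstrass_cubic g2 g3 y"
proof -
  have "r\<^sup>2 < y\<^sup>2" using assms root_pos by (intro power_strict_mono) auto
  moreover have "r * r \<le> y * r" using assms root_pos by (intro mult_right_mono) auto
  ultimately show ?thesis
    using assms root_lower unfolding weierstrass_cubic_factor
    by (intro mult_pos_pos) (auto simp: power2_eq_square)
qed

text \<open>The branch comes down from infinity and cannot cross \<open>r\<close>, because the cubic is negative just
  below its simple root.\<close>

lemma p_ge_root:
  assumes u_range: "0 < u" "u \<le> t"
  shows "r \<le> p u"
proof (rule ccontr)
  assume "\<not> r \<le> p u"
  let ?Q = "weierstrass_cubic g2 g3"
  have "(?Q has_real_derivative 12 * r\<^sup>2 - g2) (at r)"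
    unfolding weierstrass_cubic_def by (auto intro!: derivative_eq_intros)
  then obtain d where cubic_decreasing: "0 < d" "\<And>h. 0 < h \<Longrightarrow> h < d \<Longrightarrow> ?Q (r - h) < ?Q r"
    using DERIV_pos_inc_left[of ?Q "12 * r\<^sup>2 - g2" r] root_lower by auto
  define q where "q = max (p u) (r - d / 2)"
  have q_bounds: "p u \<le> q" "q < r" "r - d < q" using \<open>\<not> r \<le> p u\<close> cubic_decreasing(1) by (auto simp: q_def)
  hence Q_neg: "?Q q < 0" using cubic_decreasing(2)[of "r - q"] root by simp
  have "\<forall>\<^sub>F v in at_right 0. q \<le> p v \<and> 0 < v \<and> v < u"
    using u_range p_at_0 unfolding filterlim_at_top
    by (intro eventually_conj) (auto simp: eventually_at_right_field)
  then obtain v where p_v_ge: "q \<le> p v" "0 < v" "v < u"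
    using eventually_happens'[OF trivial_limit_at_right_real] by blast
  have "\<exists>w\<ge>v. w \<le> u \<and> p w = q"
    using p_v_ge u_range q_bounds(1) by (intro IVT2) (auto intro!: DERIV_isCont[OF DERIV_p])
  then obtain w where "v \<le> w" "w \<le> u" "p w = q" by blast
  hence "?Q q = (p' w)\<^sup>2" using ode[of w] u_range p_v_ge by simp
  thus False using Q_neg by simp
qed

lemma p'_neg:
  assumes u_range: "0 < u" "u < t"
  shows "p' u < 0"
proof -
  have "p' u < p' t"
  proof (rule DERIV_pos_imp_increasing[OF u_range(2)])
    fix v assume v_range: "u \<le> v" "v \<le> t"
    have "r\<^sup>2 \<le> (p v)\<^sup>2" using p_ge_root[of v] u_range v_range root_pos by (intro power_mono) auto
    thus "\<exists>y. (p' has_real_derivative y) (at v) \<and> 0 < y"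
      using u_range v_range DERIV_p'[of v] root_lower by (intro exI[of _ "6 * (p v)\<^sup>2 - g2 / 2"]) auto
  qed
  thus ?thesis by (simp add: p'_end)
qed

lemma p_end: "p t = r"
  using ode[of t] p'_end weierstrass_cubic_pos[of "p t"] p_ge_root[of t] t_pos by force

lemma p_gt_root:
  assumes u_range: "0 < u" "u < t"
  shows "r < p u"
  unfolding p_end[symmetric]
proof (rule DERIV_neg_imp_decreasing_open[OF u_range(2)])
  show "\<exists>y. (p has_real_derivative y) (at v) \<and> y < 0" if "u < v" "v < t" for v
    using that u_range DERIV_p[of v] p'_neg[of v] by auto
  show "continuous_on {u..t} p"
    using u_range by (intro continuous_at_imp_continuous_on ballI DERIV_isCont[OF DERIV_p]) auto
qed

end

locale trisection_branch =
  weierstrass_real_branch p p' "trisection_g2 x" "trisection_g3 x" "2 / (trisection_root x)\<^sup>2 - 6" t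
  for p p' :: "real \<Rightarrow> real" and x t :: real +
  assumes x_bounds: "0 < x" "x < 1"
begin

definition c :: "real \<Rightarrow> real" where
  "c u = (if u = 0 then 0 else sqrt (2 / (p u + 6)))"

definition \<theta> :: "real \<Rightarrow> real" where
  "\<theta> u = arcsin (trisection_cubic x (c u))"

lemma p_plus_6_pos: "0 < u \<Longrightarrow> u \<le> t \<Longrightarrow> 0 < p u + 6"
  using p_ge_root[of u] root_pos by linarith

lemma c_0 [simp]: "c 0 = 0"
  by (simp add: c_def)

lemma c_pos: "0 < u \<Longrightarrow> u \<le> t \<Longrightarrow> 0 < c u"
  using p_plus_6_pos[of u] by (simp add: c_def)

lemma p_eq_c: "0 < u \<Longrightarrow> u \<le> t \<Longrightarrow> p u = 2 / (c u)\<^sup>2 - 6"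
  using p_plus_6_pos[of u] by (simp add: c_def field_simps)

lemma c_end: "c t = trisection_root x"
  using t_pos trisection_root_pos[OF x_bounds] by (simp add: c_def p_end real_sqrt_divide)

lemma c_less_root: "0 < u \<Longrightarrow> u < t \<Longrightarrow> c u < trisection_root x"
  unfolding c_end[symmetric]
  using p_gt_root[of u, folded p_end] p_plus_6_pos[of t] t_pos
  by (auto simp: c_def intro!: divide_strict_left_mono mult_pos_pos)

lemma c_in_range:
  assumes "u \<in> {0..t}"
  shows "c u \<in> {0..trisection_root x}"
  using assms c_pos[of u] c_less_root[of u] c_end trisection_root_pos[OF x_bounds]
  by (cases "u = 0 \<or> u = t") auto

lemma trisection_cubic_c_in_unit_interval:
  assumes "u \<in> {0..t}"
  shows "trisection_cubic x (c u) \<in> {0..1}"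
  using c_in_range[OF assms] by (intro trisection_cubic_in_unit_interval x_bounds) auto

lemma DERIV_c:
  assumes u_range: "0 < u" "u < t"
  shows "(c has_real_derivative sqrt 2 * sqrt (1 - (trisection_cubic x (c u))\<^sup>2)) (at u)"
proof -
  define R where "R = sqrt (1 - (trisection_cubic x (c u))\<^sup>2)"
  have c_u_pos: "0 < c u" using c_pos u_range by simp
  have "trisection_cubic x (c u) \<in> {0..1}" using u_range by (intro trisection_cubic_c_in_unit_interval) auto
  hence R_squared: "R\<^sup>2 = 1 - (trisection_cubic x (c u))\<^sup>2" "0 \<le> R"
    by (auto simp: R_def abs_square_le_1)
  have "(- p' u)\<^sup>2 = 32 / c u ^ 6 * R\<^sup>2"
    using ode[of u] p_eq_c[of u] weierstrass_cubic_trisection[of "c u" x] u_range c_u_pos R_squared(1) by simp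
  also have "\<dots> = (4 * sqrt 2 / c u ^ 3 * R)\<^sup>2"
    by (simp add: power_mult_distrib power_divide flip: power_mult)
  finally have "- p' u = 4 * sqrt 2 / c u ^ 3 * R"
    by (rule power2_eq_imp_eq) (use p'_neg[OF u_range] c_u_pos R_squared in auto)
  hence p'_eq: "p' u = - (4 * sqrt 2 / c u ^ 3 * R)" by simp
  have "((\<lambda>u. sqrt (2 / (p u + 6))) has_real_derivative
      - (2 * p' u / (p u + 6)\<^sup>2) * (inverse (sqrt (2 / (p u + 6))) / 2)) (at u)"
    using p_plus_6_pos[of u] u_range by (auto intro!: derivative_eq_intros DERIV_p simp: power2_eq_square)
  also have "- (2 * p' u / (p u + 6)\<^sup>2) * (inverse (sqrt (2 / (p u + 6))) / 2)
      = - (p' u / (2 / (c u)\<^sup>2)\<^sup>2 / c u)"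
    using p_eq_c[of u] u_range by (simp add: c_def field_simps)
  also have "\<dots> = sqrt 2 * R"
    unfolding p'_eq using c_u_pos by (simp add: field_simps power2_eq_square power3_eq_cube)
  finally show ?thesis unfolding R_def
    by (rule has_field_derivative_transform_within_open[where S = "{0<..<t}"])
       (use u_range in \<open>auto simp: c_def\<close>)
qed

lemma continuous_on_c: "continuous_on {0..t} c"
proof (rule continuous_on_IccI[OF _ _ _ t_pos])
  have "filterlim (\<lambda>u. p u + 6) at_top (at_right 0)"
    using filterlim_tendsto_add_at_top[OF tendsto_const[of 6] p_at_0] by (simp add: add.commute)
  hence "((\<lambda>u. sqrt (2 / (p u + 6))) \<longlongrightarrow> sqrt 0) (at_right 0)"
    by (intro tendsto_real_sqrt real_tendsto_divide_at_top[OF tendsto_const])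
  moreover have "\<forall>\<^sub>F u in at_right 0. sqrt (2 / (p u + 6)) = c u"
    using eventually_at_right_less[of 0] by eventually_elim (simp add: c_def)
  ultimately show "(c \<longlongrightarrow> c 0) (at_right 0)"
    using Lim_transform_eventually by fastforce
next
  have "isCont (\<lambda>u. sqrt (2 / (p u + 6))) t"
    using p_plus_6_pos[of t] t_pos by (intro continuous_intros DERIV_isCont[OF DERIV_p]) auto
  hence "((\<lambda>u. sqrt (2 / (p u + 6))) \<longlongrightarrow> c t) (at_left t)"
    using t_pos by (simp add: isCont_def c_def filterlim_at_split)
  moreover have "\<forall>\<^sub>F u in at_left t. sqrt (2 / (p u + 6)) = c u"
    using eventually_at_left_real[OF t_pos] by eventually_elim (simp add: c_def)
  ultimately show "(c \<longlongrightarrow> c t) (at_left t)"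
    by (rule Lim_transform_eventually)
next
  show "c \<midarrow>u\<rightarrow> c u" if "0 < u" "u < t" for u
    using DERIV_isCont[OF DERIV_c[OF that]] by (simp add: isCont_def)
qed

lemma sin_\<theta>: "u \<in> {0..t} \<Longrightarrow> sin (\<theta> u) = trisection_cubic x (c u)"
  unfolding \<theta>_def using trisection_cubic_c_in_unit_interval[of u] by (intro sin_arcsin) auto

lemma \<theta>_in_range: "u \<in> {0..t} \<Longrightarrow> \<theta> u \<in> {0..pi / 2}"
  unfolding \<theta>_def using trisection_cubic_c_in_unit_interval[of u] arcsin_bounded
    arcsin_le_arcsin[of 0 "trisection_cubic x (c u)"] by auto

lemma \<theta>_0: "\<theta> 0 = 0" and \<theta>_end: "\<theta> t = pi / 2"
  by (simp_all add: \<theta>_def c_end trisection_cubic_root[OF x_bounds])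

lemma continuous_on_\<theta>: "continuous_on {0..t} \<theta>"
  unfolding \<theta>_def
proof (rule continuous_on_arcsin)
  show "\<forall>u\<in>{0..t}. - 1 \<le> trisection_cubic x (c u) \<and> trisection_cubic x (c u) \<le> 1"
    using trisection_cubic_c_in_unit_interval by force
  show "continuous_on {0..t} (\<lambda>u. trisection_cubic x (c u))"
    unfolding trisection_cubic_def by (intro continuous_intros continuous_on_c)
qed

lemma DERIV_\<theta>:
  assumes u_range: "0 < u" "u < t"
  shows "(\<theta> has_real_derivative 3 * sqrt 2 * (1 - 4 * x * (c u)\<^sup>2)) (at u)"
proof -
  define T where "T u = trisection_cubic x (c u)" for u
  have "T u < trisection_cubic x (trisection_root x)"
    unfolding T_def using c_pos[of u] c_less_root[OF u_range] u_range x_bounds trisection_root_upper[OF x_bounds]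
    by (intro trisection_cubic_strict_mono) auto
  moreover have "0 \<le> T u" using trisection_cubic_c_in_unit_interval[of u] u_range by (simp add: T_def)
  ultimately have T_range: "0 \<le> T u" "T u < 1" by (simp_all add: trisection_cubic_root[OF x_bounds])
  hence nonzero: "sqrt (1 - (T u)\<^sup>2) \<noteq> 0" by (simp add: abs_square_eq_1)
  have "(T has_real_derivative 3 * sqrt 2 * (1 - 4 * x * (c u)\<^sup>2) * sqrt (1 - (T u)\<^sup>2)) (at u)"
    unfolding T_def trisection_cubic_def
    by (auto intro!: derivative_eq_intros DERIV_c[unfolded trisection_cubic_def] u_range
        simp: algebra_simps power2_eq_square)
  hence "((\<lambda>u. arcsin (T u)) has_real_derivative
      3 * sqrt 2 * (1 - 4 * x * (c u)\<^sup>2) * sqrt (1 - (T u)\<^sup>2) * inverse (sqrt (1 - (T u)\<^sup>2))) (at u)"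
    using T_range by (intro DERIV_cong[OF DERIV_chain2[OF DERIV_arcsin]]) auto
  thus ?thesis unfolding mult.assoc right_inverse[OF nonzero] by (simp add: \<theta>_def[abs_def] T_def)
qed

lemma hyp2F1_sin_\<theta>:
  assumes u_range: "u \<in> {0..t}"
  shows "(1 - 4 * x * (c u)\<^sup>2) * hyp2F1 (1/3) (2/3) (1/2) (x * (sin (\<theta> u))\<^sup>2) = 1"
proof -
  define s where "s = sqrt x * c u"
  have s_squared: "s\<^sup>2 = x * (c u)\<^sup>2" using x_bounds by (simp add: s_def power_mult_distrib)
  have "(c u)\<^sup>2 \<le> (trisection_root x)\<^sup>2" using c_in_range[OF u_range] by (intro power_mono) auto
  hence "4 * x * (c u)\<^sup>2 \<le> 4 * x * (trisection_root x)\<^sup>2" using x_bounds by (intro mult_left_mono) auto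
  hence less_1: "4 * x * (c u)\<^sup>2 < 1" using trisection_root_upper[OF x_bounds] by linarith
  hence "4 * s\<^sup>2 < 1" by (simp only: s_squared mult.assoc)
  hence "s\<^sup>2 < (1/2)\<^sup>2" by (simp add: power_one_over)
  hence s_range: "0 \<le> s" "s < 1/2"
    using c_in_range[OF u_range] x_bounds power2_less_imp_less[of s "1/2"] by (auto simp: s_def)
  have "x * (sin (\<theta> u))\<^sup>2 = (sqrt x * trisection_cubic x (c u))\<^sup>2"
    using x_bounds by (simp add: sin_\<theta>[OF u_range] power_mult_distrib)
  also have "\<dots> = (trisection_cubic 1 s)\<^sup>2" using x_bounds by (simp add: s_def trisection_cubic_scale)
  finally show ?thesis
    using hyp2F1_trisection[OF s_range] less_1 by (simp add: s_squared mult.assoc)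
qed

theorem half_period_eq_hyp2F1: "t = pi / (6 * sqrt 2) * hyp2F1 (1/3) (2/3) 1 x"
proof -
  define f where "f \<phi> = hyp2F1 (1/3) (2/3) (1/2) (x * (sin \<phi>)\<^sup>2)" for \<phi>
  have abs_less_1: "\<bar>x * (sin \<phi>)\<^sup>2\<bar> < 1" for \<phi>
  proof -
    have "x * (sin \<phi>)\<^sup>2 \<le> x * 1" using x_bounds by (intro mult_left_mono) (auto simp: abs_square_le_1)
    also have "\<dots> < 1" using x_bounds by simp
    finally show ?thesis using x_bounds by simp
  qed
  have "isCont f \<phi>" for \<phi>
    unfolding f_def
    by (rule isCont_o2[where f = "\<lambda>\<phi>. x * (sin \<phi>)\<^sup>2", OF _ isCont_hyp2F1[OF abs_less_1]])
       (intro continuous_intros)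
  hence f_cont: "continuous_on {0..pi / 2} f"
    by (intro continuous_at_imp_continuous_on) auto
  have "((\<lambda>u. (3 * sqrt 2 * (1 - 4 * x * (c u)\<^sup>2)) *\<^sub>R f (\<theta> u)) has_integral integral {\<theta> 0..\<theta> t} f) {0..t}"
  proof (rule has_integral_substitution_strong[OF _ _ _ _ f_cont continuous_on_\<theta>, of "{0, t}"])
    show "\<theta> ` {0..t} \<subseteq> {0..pi / 2}" using \<theta>_in_range by blast
    show "(\<theta> has_real_derivative 3 * sqrt 2 * (1 - 4 * x * (c u)\<^sup>2)) (at u within {0..t})"
      if "u \<in> {0..t} - {0, t}" for u
      using that by (intro has_field_derivative_at_within[OF DERIV_\<theta>]) auto
    show "\<theta> 0 \<le> \<theta> t" by (simp add: \<theta>_0 \<theta>_end)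
  qed (use t_pos in auto)
  hence "((\<lambda>u. 3 * sqrt 2) has_integral integral {\<theta> 0..\<theta> t} f) {0..t}"
    by (rule has_integral_eq[rotated]) (simp add: f_def mult.assoc hyp2F1_sin_\<theta>[unfolded mult.assoc])
  moreover have "((\<lambda>u. 3 * sqrt 2) has_integral 3 * sqrt 2 * t) {0..t}"
    using has_integral_const_real[of "3 * sqrt 2" 0 t] t_pos by (simp add: mult_ac)
  ultimately have "integral {0..pi / 2} f = 3 * sqrt 2 * t"
    unfolding \<theta>_0 \<theta>_end by (rule has_integral_unique)
  moreover have "integral {0..pi / 2} f = pi / 2 * hyp2F1 (1/3) (2/3) 1 x"
    unfolding f_def using x_bounds by (intro integral_unique has_integral_hyp2F1_half) auto
  ultimately show ?thesis by (simp add: field_simps)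
qed

end

section \<open>Infinite sums of functions\<close>

lemma has_field_derivative_infsum:
  fixes f f' :: "'i \<Rightarrow> complex \<Rightarrow> complex"
  assumes S_nhds: "open S" "z \<in> S"
    and deriv: "\<And>q u. q \<in> A \<Longrightarrow> u \<in> S \<Longrightarrow> (f q has_field_derivative f' q u) (at u)"
    and norm_le: "\<And>q u. q \<in> A \<Longrightarrow> u \<in> S \<Longrightarrow> norm (f q u) \<le> M q" and summable_M: "M summable_on A"
  shows "((\<lambda>u. \<Sum>\<^sub>\<infinity>q\<in>A. f q u) has_field_derivative (\<Sum>\<^sub>\<infinity>q\<in>A. f' q z)) (at z)"
    and "(\<lambda>q. f' q z) summable_on A"
proof -
  obtain r where cball_subset: "0 < r" "cball z r \<subseteq> S" using S_nhds by (meson open_contains_cball)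
  have uniform_limit_infsum: "uniform_limit (cball z r) (\<lambda>X u. \<Sum>q\<in>X. f q u) (\<lambda>u. \<Sum>\<^sub>\<infinity>q\<in>A. f q u) (finite_subsets_at_top A)"
    by (rule Weierstrass_m_test_general[OF _ summable_M]) (use norm_le cball_subset in blast)
  have "\<forall>\<^sub>F X in finite_subsets_at_top A. continuous_on (cball z r) (\<lambda>u. \<Sum>q\<in>X. f q u) \<and>
      (\<forall>u\<in>ball z r. ((\<lambda>u. \<Sum>q\<in>X. f q u) has_field_derivative (\<Sum>q\<in>X. f' q u)) (at u))"
  proof (rule eventually_finite_subsets_at_top_weakI)
    fix X assume "finite X" "X \<subseteq> A"
    hence "((\<lambda>u. \<Sum>q\<in>X. f q u) has_field_derivative (\<Sum>q\<in>X. f' q u)) (at u)" if "u \<in> cball z r" for u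
      using that cball_subset by (intro DERIV_sum deriv) auto
    thus "continuous_on (cball z r) (\<lambda>u. \<Sum>q\<in>X. f q u) \<and>
        (\<forall>u\<in>ball z r. ((\<lambda>u. \<Sum>q\<in>X. f q u) has_field_derivative (\<Sum>q\<in>X. f' q u)) (at u))"
      by (auto intro!: continuous_at_imp_continuous_on DERIV_isCont)
  qed
  from has_complex_derivative_uniform_limit[OF this uniform_limit_infsum finite_subsets_at_top_neq_bot cball_subset(1)]
  obtain g' where limit_deriv: "((\<lambda>u. \<Sum>\<^sub>\<infinity>q\<in>A. f q u) has_field_derivative g' z) (at z)"
    "((\<lambda>X. \<Sum>q\<in>X. f' q z) \<longlongrightarrow> g' z) (finite_subsets_at_top A)"
    using cball_subset(1) centre_in_ball by metis
  hence "((\<lambda>q. f' q z) has_sum g' z) A" by (simp add: has_sum_def)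
  thus "((\<lambda>u. \<Sum>\<^sub>\<infinity>q\<in>A. f q u) has_field_derivative (\<Sum>\<^sub>\<infinity>q\<in>A. f' q z)) (at z)"
    "(\<lambda>q. f' q z) summable_on A"
    using limit_deriv(1) by (auto simp: infsumI has_sum_imp_summable)
qed

lemma tendsto_infsum_dominated:
  fixes f :: "'i \<Rightarrow> 'b \<Rightarrow> 'c :: banach"
  assumes tendsto_f: "\<And>q. q \<in> A \<Longrightarrow> (f q \<longlongrightarrow> g q) F"
    and norm_le: "\<And>q y. q \<in> A \<Longrightarrow> y \<in> Y \<Longrightarrow> norm (f q y) \<le> M q" and summable_M: "M summable_on A"
    and eventually_Y: "\<forall>\<^sub>F y in F. y \<in> Y" and F_nontriv: "F \<noteq> bot"
  shows "((\<lambda>y. \<Sum>\<^sub>\<infinity>q\<in>A. f q y) \<longlongrightarrow> (\<Sum>\<^sub>\<infinity>q\<in>A. g q)) F"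
proof (rule swap_uniform_limit'[where S = Y])
  show "\<forall>\<^sub>F X in finite_subsets_at_top A. ((\<lambda>y. \<Sum>q\<in>X. f q y) \<longlongrightarrow> (\<Sum>q\<in>X. g q)) F"
    by (rule eventually_finite_subsets_at_top_weakI) (auto intro!: tendsto_sum tendsto_f)
  have "norm (g q) \<le> M q" if "q \<in> A" for q
    using tendsto_le[OF F_nontriv tendsto_const tendsto_norm[OF tendsto_f[OF that]]] norm_le[OF that] eventually_Y
    by (metis (mono_tags, lifting) eventually_mono)
  hence "(\<lambda>q. norm (g q)) summable_on A" by (rule Infinite_Sum.abs_summable_on_comparison_test'[OF summable_M])
  thus "((\<lambda>X. \<Sum>q\<in>X. g q) \<longlongrightarrow> (\<Sum>\<^sub>\<infinity>q\<in>A. g q)) (finite_subsets_at_top A)"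
    using has_sum_infsum[OF abs_summable_summable] by (simp add: has_sum_def)
  show "uniform_limit Y (\<lambda>X y. \<Sum>q\<in>X. f q y) (\<lambda>y. \<Sum>\<^sub>\<infinity>q\<in>A. f q y) (finite_subsets_at_top A)"
    using norm_le summable_M by (rule Weierstrass_m_test_general)
qed (use eventually_Y in auto)

lemma summable_on_int_powr:
  fixes s :: real
  assumes "1 < s"
  shows "(\<lambda>m::int. (1 + \<bar>real_of_int m\<bar>) powr - s) summable_on UNIV"
proof -
  let ?f = "\<lambda>m::int. (1 + \<bar>real_of_int m\<bar>) powr - s"
  have "summable (\<lambda>n. real (Suc n) powr - s)"
    using assms by (subst summable_Suc_iff[where f = "\<lambda>n. real n powr - s"]) (simp add: summable_real_powr_iff)
  hence summable_on_nat: "(\<lambda>n::nat. (1 + real n) powr - s) summable_on UNIV"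
    by (intro summable_nonneg_imp_summable_on) (auto simp: add.commute)
  have "?f summable_on range int"
    using summable_on_nat by (subst summable_on_reindex) (auto simp: o_def)
  moreover have "?f summable_on range (\<lambda>n. - int n)"
    using summable_on_nat by (subst summable_on_reindex) (auto simp: o_def inj_on_def)
  ultimately have "?f summable_on (range int \<union> range (\<lambda>n. - int n))"
    by (rule summable_on_union)
  also have "range int \<union> range (\<lambda>n. - int n) = UNIV"
    by (auto simp: image_iff) (metis int_cases2)
  finally show ?thesis .
qed

lemma summable_on_int_pair_powr:
  fixes s :: real
  assumes s_gt_1: "1 < s"
  shows "(\<lambda>q. ((1 + \<bar>real_of_int (fst q)\<bar>) * (1 + \<bar>real_of_int (snd q)\<bar>)) powr - s) summable_on UNIV"
proof -
  let ?f = "\<lambda>m::int. (1 + \<bar>real_of_int m\<bar>) powr - s"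
  have "(\<lambda>(m, n). ?f m * ?f n) summable_on (UNIV \<times> UNIV)"
  proof (rule summable_on_SigmaI)
    show "((\<lambda>n. case (m, n) of (m, n) \<Rightarrow> ?f m * ?f n) has_sum ?f m * infsum ?f UNIV) UNIV" for m
      using has_sum_cmult_right[OF has_sum_infsum[OF summable_on_int_powr[OF s_gt_1]]] by simp
    show "(\<lambda>m. ?f m * infsum ?f UNIV) summable_on UNIV"
      by (intro summable_on_cmult_left summable_on_int_powr s_gt_1)
  qed auto
  thus ?thesis by (simp add: powr_mult case_prod_unfold)
qed

section \<open>Eisenstein sums of rectangular lattices\<close>

definition lattice_point :: "real \<Rightarrow> real \<Rightarrow> int \<times> int \<Rightarrow> complex" where
  "lattice_point a b q = Complex (2 * of_int (fst q) * a) (2 * of_int (snd q) * b)"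

lemma lattice_point_sel [simp]:
  "Re (lattice_point a b q) = 2 * of_int (fst q) * a"
  "Im (lattice_point a b q) = 2 * of_int (snd q) * b"
  by (simp_all add: lattice_point_def)

lemma lattice_point_0 [simp]: "lattice_point a b 0 = 0"
  by (simp add: complex_eq_iff)

lemma lattice_point_eq_0_iff:
  assumes "a \<noteq> 0" "b \<noteq> 0"
  shows "lattice_point a b q = 0 \<longleftrightarrow> q = 0"
  using assms by (auto simp: complex_eq_iff prod_eq_iff)

lemma lattice_point_add: "lattice_point a b (q + r) = lattice_point a b q + lattice_point a b r"
  and lattice_point_diff: "lattice_point a b (q - r) = lattice_point a b q - lattice_point a b r"
  and lattice_point_uminus: "lattice_point a b (- q) = - lattice_point a b q"
  by (simp_all add: complex_eq_iff algebra_simps)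

lemma cnj_lattice_point: "cnj (lattice_point a b q) = lattice_point a b (fst q, - snd q)"
  by (simp add: complex_eq_iff)

text \<open>The term at \<open>q = 0\<close> vanishes by the convention \<open>1 / 0 = 0\<close>.\<close>

definition eisenstein_sum :: "real \<Rightarrow> real \<Rightarrow> nat \<Rightarrow> complex" where
  "eisenstein_sum a b k = (\<Sum>\<^sub>\<infinity>q. 1 / lattice_point a b q ^ k)"

lemma lattice_g2_eq: "lattice_g2 (of_real a) (\<i> * of_real b) = 60 * eisenstein_sum a b 4"
  and lattice_g3_eq: "lattice_g3 (of_real a) (\<i> * of_real b) = 140 * eisenstein_sum a b 6"
proof -
  have "2 * of_int m * of_real a + 2 * of_int n * (\<i> * of_real b) = lattice_point a b (m, n)" for m n
    by (simp add: complex_eq_iff)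
  moreover have "infsum (\<lambda>(m, n). 1 / lattice_point a b (m, n) ^ k) (UNIV - {(0, 0)}) = eisenstein_sum a b k"
    if "0 < k" for k
    unfolding eisenstein_sum_def using that
    by (intro infsum_cong_neutral) (auto simp: case_prod_unfold simp flip: zero_prod_def)
  ultimately show "lattice_g2 (of_real a) (\<i> * of_real b) = 60 * eisenstein_sum a b 4"
    "lattice_g3 (of_real a) (\<i> * of_real b) = 140 * eisenstein_sum a b 6"
    by (simp_all add: lattice_g2_def lattice_g3_def)
qed

lemma eisenstein_sum_odd:
  assumes "odd k"
  shows "eisenstein_sum a b k = 0"
proof -
  have "eisenstein_sum a b k = (\<Sum>\<^sub>\<infinity>q. - (1 / lattice_point a b q ^ k))"
    unfolding eisenstein_sum_def using assms
    by (intro infsum_reindex_bij_witness[where i = uminus and j = uminus])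
       (auto simp: lattice_point_uminus power_minus_odd)
  thus ?thesis by (simp add: infsum_uminus eisenstein_sum_def)
qed

lemma cnj_eisenstein_sum: "cnj (eisenstein_sum a b k) = eisenstein_sum a b k"
  unfolding eisenstein_sum_def infsum_cnj[symmetric]
  by (rule infsum_reindex_bij_witness[where i = "\<lambda>q. (fst q, - snd q)" and j = "\<lambda>q. (fst q, - snd q)"])
     (auto simp: cnj_lattice_point)

lemma of_real_Re_eisenstein_sum: "of_real (Re (eisenstein_sum a b k)) = eisenstein_sum a b k"
  using cnj_eisenstein_sum[of a b k] by (simp add: complex_eq_iff)

lemma eisenstein_sum_scale: "eisenstein_sum (c * a) (c * b) k = eisenstein_sum a b k / of_real c ^ k"
proof -
  have "1 / lattice_point (c * a) (c * b) q ^ k = 1 / of_real c ^ k * (1 / lattice_point a b q ^ k)" for q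
  proof -
    have "lattice_point (c * a) (c * b) q = of_real c * lattice_point a b q"
      by (simp add: complex_eq_iff)
    thus ?thesis by (simp add: power_mult_distrib)
  qed
  thus ?thesis unfolding eisenstein_sum_def by (simp only: infsum_cmult_right') simp
qed

lemma eisenstein_sum_swap: "eisenstein_sum b a k = (- \<i>) ^ k * eisenstein_sum a b k"
proof -
  have "eisenstein_sum b a k = (\<Sum>\<^sub>\<infinity>q. (- \<i>) ^ k * (1 / lattice_point a b q ^ k))"
    unfolding eisenstein_sum_def
  proof (rule infsum_reindex_bij_witness[where i = "\<lambda>q. (- snd q, fst q)" and j = "\<lambda>q. (snd q, - fst q)"])
    fix q
    have "lattice_point b a q = \<i> * lattice_point a b (snd q, - fst q)"
      by (simp add: complex_eq_iff)
    thus "(- \<i>) ^ k * (1 / lattice_point a b (snd q, - fst q) ^ k) = 1 / lattice_point b a q ^ k"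
      by (simp add: power_mult_distrib divide_simps flip: power_mult_distrib)
  qed auto
  thus ?thesis by (simp only: infsum_cmult_right' eisenstein_sum_def)
qed

section \<open>The Weierstrass function of a rectangular lattice\<close>

lemma DERIV_one_over_power:
  fixes z c :: "'a :: real_normed_field"
  assumes "z \<noteq> c"
  shows "((\<lambda>z. 1 / (z - c) ^ k) has_field_derivative - of_nat k * (1 / (z - c) ^ Suc k)) (at z)"
proof (cases k)
  case (Suc n)
  have "((\<lambda>z. (z - c) ^ k) has_field_derivative of_nat k * (z - c) ^ n) (at z)"
    by (rule derivative_eq_intros refl)+ (simp add: Suc)
  from DERIV_inverse_fun[OF this] assms
  have "((\<lambda>z. 1 / (z - c) ^ k) has_field_derivative
      - (inverse ((z - c) ^ k) * (of_nat k * (z - c) ^ n) * inverse ((z - c) ^ k))) (at z)"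
    by (simp add: inverse_eq_divide)
  also have "- (inverse ((z - c) ^ k) * (of_nat k * (z - c) ^ n) * inverse ((z - c) ^ k))
      = - of_nat k * (1 / (z - c) ^ Suc k)"
    using assms by (simp add: Suc divide_simps)
  finally show ?thesis .
qed simp

lemma DERIV_along_imaginary:
  assumes "(f has_field_derivative D) (at (c + \<i> * of_real u))"
  shows DERIV_Re_along_imaginary: "((\<lambda>u. Re (f (c + \<i> * of_real u))) has_real_derivative - Im D) (at u)"
    and DERIV_Im_along_imaginary: "((\<lambda>u. Im (f (c + \<i> * of_real u))) has_real_derivative Re D) (at u)"
proof -
  have "((\<lambda>u. c + \<i> * of_real u) has_vector_derivative \<i>) (at u)"
    by (auto intro!: derivative_eq_intros)
  hence "((f \<circ> (\<lambda>u. c + \<i> * of_real u)) has_vector_derivative (\<i> * D)) (at u)"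
    using assms by (rule field_vector_diff_chain_at)
  hence vector_derivative: "((\<lambda>u. f (c + \<i> * of_real u)) has_vector_derivative (\<i> * D)) (at u)"
    by (simp add: o_def)
  show "((\<lambda>u. Re (f (c + \<i> * of_real u))) has_real_derivative - Im D) (at u)"
    using has_field_derivative_Re[OF vector_derivative] by simp
  show "((\<lambda>u. Im (f (c + \<i> * of_real u))) has_real_derivative Re D) (at u)"
    using has_field_derivative_Im[OF vector_derivative] by simp
qed

lemma weierstrass_ode_cancellation:
  fixes z g4 g6 k l :: "'a :: field_char_0"
  assumes "z \<noteq> 0"
  defines "y \<equiv> 3 * g4 * z + 5 * g6 * z ^ 3 + z ^ 3 * k" and "v \<equiv> 6 * g4 * z + 20 * g6 * z ^ 3 + z ^ 3 * l"
  shows "(- 2 / z ^ 3 + v)\<^sup>2 - 4 * (1 / z\<^sup>2 + z * y) ^ 3 + 60 * g4 * (1 / z\<^sup>2 + z * y) + 140 * g6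
    = - 4 * l - 12 * k + v\<^sup>2 - 12 * y\<^sup>2 - 4 * (z * y) ^ 3 + 60 * g4 * (z * y)"
proof -
  define i where "i = 1 / z"
  have "z * i = 1" using assms(1) by (simp add: i_def)
  hence cancel_power: "z ^ n * i ^ n = 1" for n by (simp flip: power_mult_distrib)
  have i3_v: "i ^ 3 * v = 6 * g4 * i\<^sup>2 + 20 * g6 + l"
  proof -
    have "i ^ 3 * v = 6 * g4 * i\<^sup>2 * (z ^ 1 * i ^ 1) + (20 * g6 + l) * (z ^ 3 * i ^ 3)"
      by (simp add: v_def algebra_simps power_numeral_reduce)
    thus ?thesis by (simp only: cancel_power) simp
  qed
  have i4_zy: "i ^ 4 * (z * y) = 3 * g4 * i\<^sup>2 + 5 * g6 + k"
  proof -
    have "i ^ 4 * (z * y) = 3 * g4 * i\<^sup>2 * (z ^ 2 * i ^ 2) + (5 * g6 + k) * (z ^ 4 * i ^ 4)"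
      by (simp add: y_def algebra_simps power_numeral_reduce)
    thus ?thesis by (simp only: cancel_power) simp
  qed
  have i2_zy2: "i\<^sup>2 * (z * y)\<^sup>2 = y\<^sup>2"
    using cancel_power[of 2] by (simp add: power_mult_distrib mult_ac)
  have "(- 2 / z ^ 3 + v)\<^sup>2 - 4 * (1 / z\<^sup>2 + z * y) ^ 3 + 60 * g4 * (1 / z\<^sup>2 + z * y) + 140 * g6
      = (- 2 * i ^ 3 + v)\<^sup>2 - 4 * (i\<^sup>2 + z * y) ^ 3 + 60 * g4 * (i\<^sup>2 + z * y) + 140 * g6"
    by (simp add: i_def power_divide)
  also have "\<dots> = - 4 * (i ^ 3 * v) + v\<^sup>2 - 12 * (i ^ 4 * (z * y)) - 12 * (i\<^sup>2 * (z * y)\<^sup>2)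
      - 4 * (z * y) ^ 3 + 60 * g4 * (i\<^sup>2 + z * y) + 140 * g6"
    by (simp add: power_numeral_reduce algebra_simps)
  also have "\<dots> = - 4 * l - 12 * k + v\<^sup>2 - 12 * y\<^sup>2 - 4 * (z * y) ^ 3 + 60 * g4 * (z * y)"
    unfolding i3_v i4_zy i2_zy2 by (simp add: algebra_simps)
  finally show ?thesis .
qed

locale rect_lattice =
  fixes a b :: real
  assumes a_pos: "0 < a" and b_pos: "0 < b"
begin

abbreviation w :: "int \<times> int \<Rightarrow> complex" where "w \<equiv> lattice_point a b"

abbreviation G :: "nat \<Rightarrow> complex" where "G \<equiv> eisenstein_sum a b"

definition inradius :: real where "inradius = min a b"

lemma inradius_pos: "0 < inradius"
  using a_pos b_pos by (simp add: inradius_def)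

lemma norm_w_ge: "2 * inradius * max \<bar>of_int (fst q)\<bar> \<bar>of_int (snd q)\<bar> \<le> norm (w q)"
proof -
  have "inradius * \<bar>of_int (fst q)\<bar> \<le> a * \<bar>of_int (fst q)\<bar>"
    "inradius * \<bar>of_int (snd q)\<bar> \<le> b * \<bar>of_int (snd q)\<bar>"
    by (intro mult_right_mono; simp add: inradius_def)+
  moreover have "2 * a * \<bar>of_int (fst q)\<bar> \<le> norm (w q)" "2 * b * \<bar>of_int (snd q)\<bar> \<le> norm (w q)"
    using abs_Re_le_cmod[of "w q"] abs_Im_le_cmod[of "w q"] a_pos b_pos
    by (simp_all add: abs_mult mult_ac)
  ultimately show ?thesis by (auto simp: max_def)
qed

lemma w_eq_0_iff [simp]: "w q = 0 \<longleftrightarrow> q = 0"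
  using a_pos b_pos by (simp add: lattice_point_eq_0_iff)

lemma max_abs_ge_1:
  fixes q :: "int \<times> int"
  assumes "q \<noteq> 0"
  shows "1 \<le> max \<bar>real_of_int (fst q)\<bar> \<bar>real_of_int (snd q)\<bar>"
  using assms by (cases q) (auto simp: zero_prod_def le_max_iff_disj)

lemma norm_w_ge_inradius:
  assumes "q \<noteq> 0"
  shows "2 * inradius \<le> norm (w q)"
  using mult_left_mono[OF max_abs_ge_1[OF assms], of "2 * inradius"] norm_w_ge[of q] inradius_pos
  by linarith

lemma finite_norm_w_less: "finite {q. norm (w q) < R}"
proof (rule finite_subset)
  define N where "N = \<lceil>R / (2 * inradius)\<rceil>"
  show "{q. norm (w q) < R} \<subseteq> {-N..N} \<times> {-N..N}"
  proof
    fix q assume norm_q: "q \<in> {q. norm (w q) < R}"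
    define m where "m = max \<bar>real_of_int (fst q)\<bar> \<bar>real_of_int (snd q)\<bar>"
    have "2 * inradius * m < R" using norm_q norm_w_ge[of q] by (simp add: m_def)
    hence "m < R / (2 * inradius)" using inradius_pos by (simp add: field_simps)
    also have "\<dots> \<le> real_of_int N" by (simp add: N_def)
    finally have "\<bar>fst q\<bar> < N" "\<bar>snd q\<bar> < N" by (simp_all add: m_def flip: of_int_abs)
    thus "q \<in> {-N..N} \<times> {-N..N}" by (cases q) auto
  qed
qed auto

lemma inverse_norm_w_power_le:
  assumes "0 < k"
  shows "1 / norm (w q) ^ k \<le> 1 / inradius ^ k *
    ((1 + \<bar>real_of_int (fst q)\<bar>) * (1 + \<bar>real_of_int (snd q)\<bar>)) powr - (real k / 2)"
proof (cases "q = 0")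
  case True
  thus ?thesis using assms inradius_pos by (simp add: zero_power)
next
  case False
  define P where "P = (1 + \<bar>real_of_int (fst q)\<bar>) * (1 + \<bar>real_of_int (snd q)\<bar>)"
  define M where "M = max \<bar>real_of_int (fst q)\<bar> \<bar>real_of_int (snd q)\<bar>"
  have M_ge: "1 \<le> M" using max_abs_ge_1[OF False] by (simp add: M_def)
  have P_pos: "0 < P" unfolding P_def by (intro mult_pos_pos) auto
  have "P \<le> (2 * M) * (2 * M)" unfolding P_def using M_ge by (intro mult_mono) (auto simp: M_def)
  hence "sqrt P \<le> 2 * M" using M_ge by (intro real_le_lsqrt) (auto simp: power2_eq_square)
  hence "inradius * sqrt P \<le> inradius * (2 * M)" using M_ge inradius_pos by (intro mult_left_mono) auto
  also have "\<dots> \<le> norm (w q)" using norm_w_ge[of q] by (simp add: M_def mult_ac)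
  finally have "(inradius * sqrt P) ^ k \<le> norm (w q) ^ k" using P_pos inradius_pos by (intro power_mono) auto
  hence "1 / norm (w q) ^ k \<le> 1 / (inradius * sqrt P) ^ k"
    using P_pos inradius_pos False by (intro divide_left_mono mult_pos_pos zero_less_power) auto
  also have "\<dots> = 1 / inradius ^ k * P powr - (real k / 2)"
    using P_pos by (simp add: power_mult_distrib powr_minus powr_half_sqrt[symmetric] powr_powr
        field_simps flip: powr_realpow)
  finally show ?thesis by (simp add: P_def)
qed

lemma summable_norm_w:
  assumes "3 \<le> k"
  shows "(\<lambda>q. 1 / norm (w q) ^ k) summable_on UNIV"
  using assms
  by (intro summable_on_comparison_test[OF summable_on_cmult_right[OF summable_on_int_pair_powr]
        inverse_norm_w_power_le]) auto

lemma half_norm_w_le: "norm (w q) / 2 \<le> norm (z - w q)" if "2 * norm z \<le> norm (w q)"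
  using norm_triangle_ineq2[of "w q" z] that by (simp add: norm_minus_commute)

context
  fixes f :: "int \<times> int \<Rightarrow> complex \<Rightarrow> complex" and M :: "real \<Rightarrow> int \<times> int \<Rightarrow> real"
  assumes norm_le: "\<And>R q z. 0 < R \<Longrightarrow> 2 * R \<le> norm (w q) \<Longrightarrow> norm z \<le> R \<Longrightarrow> norm (f q z) \<le> M R q"
    and summable_M: "\<And>R. 0 < R \<Longrightarrow> M R summable_on UNIV"
begin

lemma summable_on_lattice: "(\<lambda>q. f q z) summable_on A"
proof -
  define R where "R = norm z + 1"
  have R_pos: "0 < R" by (simp add: R_def add_nonneg_pos)
  have "(\<lambda>q. norm (f q z)) summable_on {q \<in> A. 2 * R \<le> norm (w q)}"
    by (rule Infinite_Sum.abs_summable_on_comparison_test'[OF summable_on_subset_banach[OF summable_M[OF R_pos]]])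
       (use norm_le R_pos in \<open>auto simp: R_def\<close>)
  moreover have "finite {q \<in> A. norm (w q) < 2 * R}"
    by (rule finite_subset[OF _ finite_norm_w_less]) auto
  ultimately have "(\<lambda>q. f q z) summable_on {q \<in> A. norm (w q) < 2 * R} \<union> {q \<in> A. 2 * R \<le> norm (w q)}"
    by (rule summable_on_union[OF summable_on_finite abs_summable_summable, rotated])
  also have "{q \<in> A. norm (w q) < 2 * R} \<union> {q \<in> A. 2 * R \<le> norm (w q)} = A" by auto
  finally show ?thesis .
qed

lemma has_field_derivative_lattice_infsum:
  assumes deriv: "\<And>q u. u \<noteq> w q \<Longrightarrow> (f q has_field_derivative f' q u) (at u)" and z_notin: "z \<notin> w ` A"
  shows "((\<lambda>u. \<Sum>\<^sub>\<infinity>q\<in>A. f q u) has_field_derivative (\<Sum>\<^sub>\<infinity>q\<in>A. f' q z)) (at z)"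
proof -
  define R where "R = norm z + 1"
  have R_pos: "0 < R" by (simp add: R_def add_nonneg_pos)
  define B C where "B = {q \<in> A. norm (w q) < 2 * R}" and "C = {q \<in> A. 2 * R \<le> norm (w q)}"
  have A_eq: "A = B \<union> C" and disj: "B \<inter> C = {}" by (auto simp: B_def C_def)
  have finite_B: "finite B" unfolding B_def by (rule finite_subset[OF _ finite_norm_w_less]) auto
  have z_in_ball: "z \<in> ball 0 R" by (simp add: R_def)
  have C_deriv: "(f q has_field_derivative f' q u) (at u)" and C_le: "norm (f q u) \<le> M R q"
    if "q \<in> C" "u \<in> ball 0 R" for q u
    using that R_pos by (auto simp: C_def intro!: deriv norm_le)
  have C_summable: "M R summable_on C" by (rule summable_on_subset_banach[OF summable_M[OF R_pos]]) simp
  note far = has_field_derivative_infsum[OF open_ball z_in_ball C_deriv C_le C_summable]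
  have "((\<lambda>u. (\<Sum>q\<in>B. f q u) + (\<Sum>\<^sub>\<infinity>q\<in>C. f q u)) has_field_derivative
      (\<Sum>q\<in>B. f' q z) + (\<Sum>\<^sub>\<infinity>q\<in>C. f' q z)) (at z)"
    using z_notin by (intro DERIV_add DERIV_sum deriv far) (auto simp: B_def)
  also have "(\<lambda>u. (\<Sum>q\<in>B. f q u) + (\<Sum>\<^sub>\<infinity>q\<in>C. f q u)) = (\<lambda>u. \<Sum>\<^sub>\<infinity>q\<in>A. f q u)"
    unfolding A_eq using finite_B disj by (subst infsum_Un_disjoint) (auto intro: summable_on_lattice)
  also have "(\<Sum>q\<in>B. f' q z) + (\<Sum>\<^sub>\<infinity>q\<in>C. f' q z) = (\<Sum>\<^sub>\<infinity>q\<in>A. f' q z)"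
    unfolding A_eq using finite_B disj far(2) by (subst infsum_Un_disjoint) auto
  finally show ?thesis .
qed

end

definition eis :: "(int \<times> int) set \<Rightarrow> nat \<Rightarrow> complex \<Rightarrow> complex" where
  "eis A k z = (\<Sum>\<^sub>\<infinity>q\<in>A. 1 / (z - w q) ^ k)"

text \<open>By the convention \<open>1 / 0 = 0\<close> the summand at \<open>q = 0\<close> is \<open>1 / z\<^sup>2\<close>.\<close>

definition wp_sum :: "(int \<times> int) set \<Rightarrow> complex \<Rightarrow> complex" where
  "wp_sum A z = (\<Sum>\<^sub>\<infinity>q\<in>A. 1 / (z - w q)\<^sup>2 - 1 / (w q)\<^sup>2)"

lemma eis_term_le:
  assumes "0 < R" "2 * R \<le> norm (w q)" "norm z \<le> R"
  shows "norm (1 / (z - w q) ^ k) \<le> 2 ^ k * (1 / norm (w q) ^ k)"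
proof -
  have half: "norm (w q) / 2 \<le> norm (z - w q)" using assms by (intro half_norm_w_le) auto
  hence "(norm (w q) / 2) ^ k \<le> norm (z - w q) ^ k" by (intro power_mono) auto
  moreover have "0 < norm (w q)" using assms by linarith
  ultimately have "1 / norm (z - w q) ^ k \<le> 1 / (norm (w q) / 2) ^ k"
    using half by (intro divide_left_mono mult_pos_pos zero_less_power) linarith+
  thus ?thesis by (simp add: norm_divide norm_power power_divide)
qed

lemma wp_term_le:
  assumes "0 < R" "2 * R \<le> norm (w q)" "norm z \<le> R"
  shows "norm (1 / (z - w q)\<^sup>2 - 1 / (w q)\<^sup>2) \<le> 10 * R * (1 / norm (w q) ^ 3)"
proof -
  define n where "n = norm (w q)"
  have n_pos: "0 < n" using assms unfolding n_def by linarith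
  have half: "n / 2 \<le> norm (z - w q)" using assms unfolding n_def by (intro half_norm_w_le) auto
  have "w q \<noteq> 0" "z \<noteq> w q" using n_pos half by (auto simp: n_def)
  hence "1 / (z - w q)\<^sup>2 - 1 / (w q)\<^sup>2 = z * (2 * w q - z) / ((w q)\<^sup>2 * (z - w q)\<^sup>2)"
    by (simp add: divide_simps) (simp add: algebra_simps power2_eq_square)
  hence "norm (1 / (z - w q)\<^sup>2 - 1 / (w q)\<^sup>2) = norm z * norm (2 * w q - z) / (n\<^sup>2 * (norm (z - w q))\<^sup>2)"
    by (simp add: norm_divide norm_mult norm_power n_def)
  also have "\<dots> \<le> R * (5/2 * n) / (n\<^sup>2 * (n / 2)\<^sup>2)"
  proof (intro frac_le mult_mono power_mono)
    have "norm (2 * w q - z) \<le> norm (2 * w q) + norm z" by (rule norm_triangle_ineq4)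
    thus "norm (2 * w q - z) \<le> 5/2 * n" using assms by (simp add: norm_mult n_def)
  qed (use assms half n_pos in auto)
  also have "\<dots> = 10 * R * (1 / n ^ 3)"
    using n_pos by (simp add: field_simps power2_eq_square power3_eq_cube)
  finally show ?thesis by (simp add: n_def)
qed

lemma summable_on_eis: "3 \<le> k \<Longrightarrow> (\<lambda>q. 1 / (z - w q) ^ k) summable_on A"
  by (rule summable_on_lattice[where f = "\<lambda>q z. 1 / (z - w q) ^ k" and
        M = "\<lambda>R q. 2 ^ k * (1 / norm (w q) ^ k)"])
     (assumption | rule eis_term_le summable_on_cmult_right summable_norm_w)+

lemma summable_on_wp_sum: "(\<lambda>q. 1 / (z - w q)\<^sup>2 - 1 / (w q)\<^sup>2) summable_on A"
  by (rule summable_on_lattice[where f = "\<lambda>q z. 1 / (z - w q)\<^sup>2 - 1 / (w q)\<^sup>2" and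
        M = "\<lambda>R q. 10 * R * (1 / norm (w q) ^ 3)"])
     (assumption | rule wp_term_le summable_on_cmult_right summable_norm_w order_refl)+

lemma DERIV_eis:
  assumes k_ge: "3 \<le> k" and z_notin: "z \<notin> w ` A"
  shows "(eis A k has_field_derivative - of_nat k * eis A (Suc k) z) (at z)"
proof -
  have "((\<lambda>z. \<Sum>\<^sub>\<infinity>q\<in>A. 1 / (z - w q) ^ k) has_field_derivative
      (\<Sum>\<^sub>\<infinity>q\<in>A. - of_nat k * (1 / (z - w q) ^ Suc k))) (at z)"
    by (rule has_field_derivative_lattice_infsum[where M = "\<lambda>R q. 2 ^ k * (1 / norm (w q) ^ k)"])
       (assumption | rule eis_term_le summable_on_cmult_right summable_norm_w k_ge DERIV_one_over_power z_notin)+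
  thus ?thesis unfolding infsum_cmult_right' eis_def[abs_def] .
qed

lemma DERIV_wp_sum:
  assumes z_notin: "z \<notin> w ` A"
  shows "(wp_sum A has_field_derivative - 2 * eis A 3 z) (at z)"
proof -
  have deriv: "((\<lambda>z. 1 / (z - w q)\<^sup>2 - 1 / (w q)\<^sup>2) has_field_derivative - 2 * (1 / (z - w q) ^ 3)) (at z)"
    if "z \<noteq> w q" for q z
    using DERIV_diff[OF DERIV_one_over_power[OF that, of 2] DERIV_const] by (simp add: eval_nat_numeral)
  have "((\<lambda>z. \<Sum>\<^sub>\<infinity>q\<in>A. 1 / (z - w q)\<^sup>2 - 1 / (w q)\<^sup>2) has_field_derivative
      (\<Sum>\<^sub>\<infinity>q\<in>A. - 2 * (1 / (z - w q) ^ 3))) (at z)"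
    by (rule has_field_derivative_lattice_infsum[where M = "\<lambda>R q. 10 * R * (1 / norm (w q) ^ 3)"])
       (assumption | rule wp_term_le summable_on_cmult_right summable_norm_w order_refl deriv z_notin)+
  thus ?thesis unfolding infsum_cmult_right' wp_sum_def[abs_def] eis_def .
qed

abbreviation wp :: "complex \<Rightarrow> complex" where "wp \<equiv> wp_sum UNIV"

definition wp' :: "complex \<Rightarrow> complex" where "wp' z = - 2 * eis UNIV 3 z"

definition wp'' :: "complex \<Rightarrow> complex" where "wp'' z = 6 * eis UNIV 4 z"

lemma DERIV_wp: "z \<notin> range w \<Longrightarrow> (wp has_field_derivative wp' z) (at z)"
  unfolding wp'_def by (rule DERIV_wp_sum)

lemma DERIV_wp':
  assumes "z \<notin> range w"
  shows "(wp' has_field_derivative wp'' z) (at z)"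
  using DERIV_cmult[OF DERIV_eis[of 3 z UNIV], of "- 2"] assms
  by (simp add: wp'_def[abs_def] wp''_def eval_nat_numeral)

lemma open_complement_lattice: "open (- range w)"
  unfolding open_contains_ball
proof
  fix z assume z_notin: "z \<in> - range w"
  define A where "A = w ` {q. norm (w q) < norm z + 1}"
  have "open (ball 0 (norm z + 1) - A)"
    unfolding A_def by (intro open_Diff open_ball finite_imp_closed finite_imageI finite_norm_w_less)
  moreover have "z \<in> ball 0 (norm z + 1) - A" using z_notin by (auto simp: A_def)
  ultimately obtain e where "e > 0" "ball z e \<subseteq> ball 0 (norm z + 1) - A"
    by (meson open_contains_ball)
  moreover have "ball 0 (norm z + 1) - A \<subseteq> - range w" by (auto simp: A_def)
  ultimately show "\<exists>e>0. ball z e \<subseteq> - range w" by blast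
qed

lemma connected_complement_lattice: "connected (- range w)"
  by (intro path_connected_imp_connected path_connected_complement_countable) auto

lemma wp_holomorphic: "wp holomorphic_on - range w"
  and wp'_holomorphic: "wp' holomorphic_on - range w"
  using DERIV_wp DERIV_wp' by (auto simp: holomorphic_on_open open_complement_lattice)

lemma wp''_holomorphic: "wp'' holomorphic_on - range w"
proof -
  have "(wp'' has_field_derivative 6 * (- of_nat 4 * eis UNIV (Suc 4) z)) (at z)" if "z \<notin> range w" for z
    unfolding wp''_def using that by (intro DERIV_cmult DERIV_eis) auto
  thus ?thesis by (auto simp: holomorphic_on_open open_complement_lattice)
qed

lemma uminus_in_range_w_iff: "- z \<in> range w \<longleftrightarrow> z \<in> range w"
  by (metis (no_types, opaque_lifting) add.inverse_inverse rangeE rangeI lattice_point_uminus)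

lemma add_in_range_w_iff: "z + w p \<in> range w \<longleftrightarrow> z \<in> range w"
  by (metis (no_types, opaque_lifting) add_diff_cancel_right' rangeE rangeI lattice_point_add lattice_point_diff)

lemma eis_add_period: "eis UNIV k (z + w p) = eis UNIV k z"
  unfolding eis_def
  by (rule infsum_reindex_bij_witness[where i = "\<lambda>q. q + p" and j = "\<lambda>q. q - p"])
     (auto simp: lattice_point_diff algebra_simps)

lemma wp'_add_period: "wp' (z + w p) = wp' z" and wp''_add_period: "wp'' (z + w p) = wp'' z"
  by (simp_all add: wp'_def wp''_def eis_add_period)

lemma wp'_uminus: "wp' (- z) = - wp' z"
proof -
  have "eis UNIV 3 (- z) = (\<Sum>\<^sub>\<infinity>q. - (1 / (z - w q) ^ 3))"
    unfolding eis_def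
  proof (rule infsum_reindex_bij_witness[where i = uminus and j = uminus])
    fix q
    have "(- z - w q) ^ 3 = - ((z - w (- q)) ^ 3)"
      using power_minus_odd[of 3 "z - w (- q)"] by (simp add: lattice_point_uminus)
    thus "- (1 / (z - w (- q)) ^ 3) = 1 / (- z - w q) ^ 3" by simp
  qed auto
  thus ?thesis by (simp add: infsum_uminus wp'_def eis_def)
qed

lemma wp_uminus: "wp (- z) = wp z"
  unfolding wp_sum_def
proof (rule infsum_reindex_bij_witness[where i = uminus and j = uminus])
  fix q
  show "1 / (z - w (- q))\<^sup>2 - 1 / (w (- q))\<^sup>2 = 1 / (- z - w q)\<^sup>2 - 1 / (w q)\<^sup>2"
    using power2_minus[of "z + w q"] by (simp add: lattice_point_uminus)
qed auto

lemma cnj_eis: "cnj (eis UNIV k z) = eis UNIV k (cnj z)"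
  unfolding eis_def infsum_cnj[symmetric]
  by (rule infsum_reindex_bij_witness[where i = "\<lambda>q. (fst q, - snd q)" and j = "\<lambda>q. (fst q, - snd q)"])
     (auto simp: cnj_lattice_point)

lemma cnj_wp': "cnj (wp' z) = wp' (cnj z)"
  by (simp add: wp'_def cnj_eis)

lemma cnj_wp: "cnj (wp z) = wp (cnj z)"
  unfolding wp_sum_def infsum_cnj[symmetric]
  by (rule infsum_reindex_bij_witness[where i = "\<lambda>q. (fst q, - snd q)" and j = "\<lambda>q. (fst q, - snd q)"])
     (auto simp: cnj_lattice_point)

lemma wp'_half_period: "wp' (w p / 2) = 0"
proof -
  have "wp' (w p / 2) = wp' (- (w p / 2) + w p)" by simp
  also have "\<dots> = - wp' (w p / 2)" by (simp only: wp'_add_period wp'_uminus)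
  finally show ?thesis by simp
qed

text \<open>The additive constant of the translation \<open>z \<mapsto> z + w p\<close> changes sign under
  \<open>z \<mapsto> - z - w p\<close>, by evenness.\<close>

lemma wp_add_period:
  assumes "z \<notin> range w"
  shows "wp (z + w p) = wp z"
proof -
  have "(\<lambda>z. wp (z + w p) - wp z) constant_on (- range w)"
  proof (rule has_field_derivative_0_imp_constant_on)
    fix u assume u_notin: "u \<in> - range w"
    have "((\<lambda>z. wp (z + w p)) has_field_derivative wp' (u + w p) * 1) (at u)"
      using u_notin by (intro DERIV_chain2[OF DERIV_wp])
        (auto simp: add_in_range_w_iff intro!: derivative_eq_intros)
    from DERIV_diff[OF this DERIV_wp[of u]] u_notin
    show "((\<lambda>z. wp (z + w p) - wp z) has_field_derivative 0) (at u)"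
      by (simp add: wp'_add_period)
  qed (auto intro: open_complement_lattice connected_complement_lattice)
  then obtain c where wp_diff: "wp (u + w p) - wp u = c" if "u \<notin> range w" for u
    by (auto simp: constant_on_def)
  have "- (z + w p) \<notin> range w"
    using assms by (simp only: uminus_in_range_w_iff add_in_range_w_iff not_False_eq_True)
  hence "c = wp (- (z + w p) + w p) - wp (- (z + w p))" by (rule wp_diff[symmetric])
  also have "- (z + w p) + w p = - z" by simp
  also have "wp (- z) - wp (- (z + w p)) = - (wp (z + w p) - wp z)" by (simp only: wp_uminus minus_diff_eq)
  also have "\<dots> = - c" by (simp only: wp_diff[OF assms])
  finally show ?thesis using wp_diff[OF assms] by simp
qed

text \<open>The \<open>i\<close>-th derivative of \<open>\<wp>(z) - 1 / z\<^sup>2\<close>.\<close>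

definition regular_deriv :: "nat \<Rightarrow> complex \<Rightarrow> complex" where
  "regular_deriv i z =
    (if i = 0 then wp_sum (- {0}) z else (- 1) ^ i * fact (Suc i) * eis (- {0}) (i + 2) z)"

lemma wp_split: "wp z = 1 / z\<^sup>2 + regular_deriv 0 z"
proof -
  have "wp_sum (insert 0 (- {0})) z = 1 / z\<^sup>2 + wp_sum (- {0}) z"
    unfolding wp_sum_def by (subst infsum_insert) (auto intro: summable_on_wp_sum)
  also have "insert 0 (- {0}) = (UNIV :: (int \<times> int) set)" by auto
  finally show ?thesis by (simp add: regular_deriv_def)
qed

lemma eis_split:
  assumes "3 \<le> k"
  shows "eis UNIV k z = 1 / z ^ k + eis (- {0}) k z"
proof -
  have "eis (insert 0 (- {0})) k z = 1 / z ^ k + eis (- {0}) k z"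
    unfolding eis_def using assms by (subst infsum_insert) (auto intro: summable_on_eis)
  also have "insert 0 (- {0}) = (UNIV :: (int \<times> int) set)" by auto
  finally show ?thesis .
qed

lemma wp'_split: "wp' z = - 2 / z ^ 3 + regular_deriv 1 z"
  by (simp add: wp'_def eis_split regular_deriv_def eval_nat_numeral algebra_simps)

lemma wp''_split: "wp'' z = 6 / z ^ 4 + regular_deriv 2 z"
  by (simp add: wp''_def eis_split regular_deriv_def eval_nat_numeral algebra_simps)

lemma regular_deriv_at_0: "regular_deriv i 0 = (if i = 0 then 0 else fact (Suc i) * G (i + 2))"
proof -
  have "eis (- {0}) k 0 = (- 1) ^ k * G k" if "0 < k" for k
  proof -
    have "eis (- {0}) k 0 = (\<Sum>\<^sub>\<infinity>q. (- 1) ^ k * (1 / w q ^ k))"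
      unfolding eis_def using that
      by (intro infsum_cong_neutral) (cases "even k"; auto simp: power_minus_odd zero_power)+
    thus ?thesis by (simp only: infsum_cmult_right' eisenstein_sum_def)
  qed
  thus ?thesis by (simp add: regular_deriv_def wp_sum_def)
qed

lemma norm_le_inradius_notin:
  assumes "norm z \<le> inradius" "0 \<notin> A"
  shows "z \<notin> w ` A"
proof
  assume "z \<in> w ` A"
  then obtain q where "z = w q" "q \<in> A" by blast
  hence "q \<noteq> 0" using assms(2) by metis
  thus False using norm_w_ge_inradius[of q] \<open>z = w q\<close> assms(1) inradius_pos by simp
qed

lemma DERIV_regular_deriv:
  assumes "norm z \<le> inradius"
  shows "(regular_deriv i has_field_derivative regular_deriv (Suc i) z) (at z)"
proof -
  have z_notin: "z \<notin> w ` (- {0})" using assms by (intro norm_le_inradius_notin) auto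
  show ?thesis
  proof (cases "i = 0")
    case True
    thus ?thesis using DERIV_wp_sum[OF z_notin] by (simp add: regular_deriv_def[abs_def] numeral_3_eq_3)
  next
    case False
    have "((\<lambda>z. (- 1) ^ i * fact (Suc i) * eis (- {0}) (i + 2) z) has_field_derivative
        (- 1) ^ i * fact (Suc i) * (- of_nat (i + 2) * eis (- {0}) (Suc (i + 2)) z)) (at z)"
      using z_notin False by (intro DERIV_cmult DERIV_eis) auto
    thus ?thesis using False by (simp add: regular_deriv_def[abs_def] algebra_simps)
  qed
qed

lemma regular_deriv_Taylor:
  obtains B where "\<And>z. norm z \<le> inradius \<Longrightarrow>
    norm (regular_deriv j z - (\<Sum>i\<le>n. regular_deriv (j + i) 0 * z ^ i / fact i)) \<le> B * norm z ^ Suc n"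
proof -
  have "continuous_on (cball 0 inradius) (regular_deriv (j + Suc n))"
    by (intro continuous_at_imp_continuous_on ballI DERIV_isCont[OF DERIV_regular_deriv]) auto
  hence "bounded (regular_deriv (j + Suc n) ` cball 0 inradius)"
    by (intro compact_imp_bounded compact_continuous_image compact_cball)
  then obtain B where deriv_le: "norm (regular_deriv (j + Suc n) z) \<le> B" if "z \<in> cball 0 inradius" for z
    unfolding bounded_iff by blast
  have deriv: "(regular_deriv (j + i) has_field_derivative regular_deriv (j + Suc i) z) (at z within cball 0 inradius)"
    if "z \<in> cball 0 inradius" for i z
    using that has_field_derivative_at_within[OF DERIV_regular_deriv[of z "j + i"]] by simp
  have "norm (regular_deriv j z - (\<Sum>i\<le>n. regular_deriv (j + i) 0 * z ^ i / fact i))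
      \<le> B / fact n * norm z ^ Suc n" if norm_z: "norm z \<le> inradius" for z
  proof -
    have "norm (regular_deriv (j + 0) z - (\<Sum>i\<le>n. regular_deriv (j + i) 0 * (z - 0) ^ i / fact i))
        \<le> B * norm (z - 0) ^ Suc n / fact n"
      by (rule complex_Taylor[where f = "\<lambda>i. regular_deriv (j + i)", OF convex_cball deriv deriv_le])
         (use norm_z inradius_pos in auto)
    thus ?thesis by simp
  qed
  thus thesis by (rule that)
qed

lemma regular_deriv_expansion:
  obtains k where "(k \<longlongrightarrow> 0) (at 0)" and "\<And>z. z \<noteq> 0 \<Longrightarrow>
    regular_deriv j z = (\<Sum>i\<le>n. regular_deriv (j + i) 0 * z ^ i / fact i) + z ^ n * k z"
proof -
  let ?T = "\<lambda>z. \<Sum>i\<le>n. regular_deriv (j + i) 0 * z ^ i / fact i"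
  obtain B where remainder: "\<And>z. norm z \<le> inradius \<Longrightarrow> norm (regular_deriv j z - ?T z) \<le> B * norm z ^ Suc n"
    using regular_deriv_Taylor[of j n] by blast
  define k where "k z = (regular_deriv j z - ?T z) / z ^ n" for z
  have "(k \<longlongrightarrow> 0) (at 0)"
  proof (rule Lim_null_comparison)
    have "norm (k z) \<le> B * norm z" if "z \<noteq> 0" "norm z < inradius" for z
      using remainder[of z] that by (simp add: k_def norm_divide norm_power divide_le_eq mult_ac)
    thus "\<forall>\<^sub>F z in at 0. norm (k z) \<le> B * norm z"
      unfolding eventually_at using inradius_pos by (intro exI[of _ inradius]) (simp add: dist_norm)
    show "((\<lambda>z. B * norm z) \<longlongrightarrow> 0) (at (0 :: complex))" by (auto intro!: tendsto_eq_intros)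
  qed
  thus thesis by (rule that) (simp add: k_def)
qed

lemma wp_expansion:
  obtains k where "(k \<longlongrightarrow> 0) (at 0)"
    and "\<And>z. z \<noteq> 0 \<Longrightarrow> wp z = 1 / z\<^sup>2 + 3 * G 4 * z\<^sup>2 + 5 * G 6 * z ^ 4 + z ^ 4 * k z"
proof -
  have "G 3 = 0" "G 5 = 0" by (simp_all add: eisenstein_sum_odd)
  hence "(\<Sum>i\<le>4. regular_deriv (0 + i) 0 * z ^ i / fact i) = 3 * G 4 * z\<^sup>2 + 5 * G 6 * z ^ 4" for z
    by (simp add: regular_deriv_at_0 eval_nat_numeral)
  with regular_deriv_expansion[of 0 4] obtain k where "(k \<longlongrightarrow> 0) (at 0)"
    and "\<And>z. z \<noteq> 0 \<Longrightarrow> regular_deriv 0 z = 3 * G 4 * z\<^sup>2 + 5 * G 6 * z ^ 4 + z ^ 4 * k z"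
    by auto
  thus thesis by (intro that[of k]) (simp_all add: wp_split)
qed

lemma wp'_expansion:
  obtains l where "(l \<longlongrightarrow> 0) (at 0)"
    and "\<And>z. z \<noteq> 0 \<Longrightarrow> wp' z = - 2 / z ^ 3 + 6 * G 4 * z + 20 * G 6 * z ^ 3 + z ^ 3 * l z"
proof -
  have "G 3 = 0" "G 5 = 0" by (simp_all add: eisenstein_sum_odd)
  hence "(\<Sum>i\<le>3. regular_deriv (1 + i) 0 * z ^ i / fact i) = 6 * G 4 * z + 20 * G 6 * z ^ 3" for z
    by (simp add: regular_deriv_at_0 eval_nat_numeral)
  with regular_deriv_expansion[of 1 3] obtain l where "(l \<longlongrightarrow> 0) (at 0)"
    and "\<And>z. z \<noteq> 0 \<Longrightarrow> regular_deriv 1 z = 6 * G 4 * z + 20 * G 6 * z ^ 3 + z ^ 3 * l z"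
    by auto
  thus thesis by (intro that[of l]) (simp_all add: wp'_split)
qed

lemma doubly_periodic_entire_constant:
  assumes hol: "F holomorphic_on UNIV" and per: "\<And>z q. F (z + w q) = F z"
  shows "F constant_on UNIV"
proof (rule Liouville_theorem[OF hol])
  let ?B = "cbox 0 (Complex (2 * a) (2 * b))"
  have "range F \<subseteq> F ` ?B"
  proof safe
    fix z
    define m n where "m = \<lfloor>Re z / (2 * a)\<rfloor>" and "n = \<lfloor>Im z / (2 * b)\<rfloor>"
    have "of_int m \<le> Re z / (2 * a)" "Re z / (2 * a) \<le> of_int m + 1"
      "of_int n \<le> Im z / (2 * b)" "Im z / (2 * b) \<le> of_int n + 1"
      unfolding m_def n_def by linarith+
    hence "z - w (m, n) \<in> ?B"
      using a_pos b_pos by (auto simp: in_cbox_complex_iff field_simps)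
    moreover have "F z = F (z - w (m, n))" using per[of "z - w (m, n)" "(m, n)"] by simp
    ultimately show "F z \<in> F ` ?B" by blast
  qed
  moreover have "compact (F ` ?B)"
    by (intro compact_continuous_image compact_cbox holomorphic_on_imp_continuous_on
        holomorphic_on_subset[OF hol]) auto
  ultimately show "bounded (range F)" using bounded_subset compact_imp_bounded by blast
qed

lemma near_0_notin_range_w:
  assumes "z \<noteq> 0" "norm z \<le> inradius"
  shows "z \<notin> range w"
proof
  assume "z \<in> range w"
  then obtain q where z_eq: "z = w q" by blast
  hence "z \<in> w ` (- {0})" using assms(1) by auto
  thus False using norm_le_inradius_notin[OF assms(2), of "- {0}"] by simp
qed

lemma doubly_periodic_holomorphic_extension:
  assumes hol: "F holomorphic_on - range w" and per: "\<And>z q. F (z + w q) = F z"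
    and tendsto: "(F \<longlongrightarrow> F 0) (at 0)"
  shows "F holomorphic_on UNIV"
proof -
  have "F holomorphic_on ball 0 inradius"
  proof (rule no_isolated_singularity'[where K = "{0}"])
    show "(F \<longlongrightarrow> F z) (at z within ball 0 inradius)" if "z \<in> {0}" for z
      using that tendsto by (auto intro: tendsto_within_subset)
    show "F holomorphic_on ball 0 inradius - {0}"
    proof (rule holomorphic_on_subset[OF hol], rule subsetI)
      fix z :: complex assume "z \<in> ball 0 inradius - {0}"
      thus "z \<in> - range w" using near_0_notin_range_w[of z] by simp
    qed
  qed auto
  hence differentiable_0: "F field_differentiable at 0"
    using inradius_pos by (auto intro: holomorphic_on_imp_differentiable_at)
  have "F field_differentiable at u" for u
  proof (cases "u \<in> range w")
    case True
    then obtain q where "u = w q" by blast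
    hence "((\<lambda>v. F (v - w q)) has_field_derivative deriv F 0 * 1) (at u)"
      using differentiable_0 by (intro DERIV_chain2[of F])
        (auto simp: field_differentiable_derivI intro!: derivative_eq_intros)
    moreover have "(\<lambda>v. F (v - w q)) = F" using per[of "_ - w q" q] by auto
    ultimately show ?thesis by (auto simp: field_differentiable_def)
  next
    case False
    thus ?thesis using hol open_complement_lattice holomorphic_on_imp_differentiable_at by blast
  qed
  thus ?thesis by (simp add: holomorphic_on_def)
qed

lemma doubly_periodic_constant:
  assumes hol: "f holomorphic_on - range w"
    and per: "\<And>z q. z \<notin> range w \<Longrightarrow> f (z + w q) = f z"
    and tendsto: "(f \<longlongrightarrow> c) (at 0)" and z_notin: "z \<notin> range w"
  shows "f z = c"
proof -
  define F where "F z = (if z \<in> range w then c else f z)" for z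
  have F_per: "F (z + w q) = F z" for z q
    by (simp add: F_def add_in_range_w_iff per)
  have F_hol: "F holomorphic_on - range w"
    using hol by (rule holomorphic_transform) (simp add: F_def)
  have F_0: "F 0 = c" using rangeI[of w 0] by (simp add: F_def)
  have "f z = F z" if "z \<noteq> 0" "norm z < inradius" for z
    using near_0_notin_range_w[of z] that by (simp add: F_def)
  hence "\<forall>\<^sub>F z in at 0. f z = F z"
    unfolding eventually_at using inradius_pos by (intro exI[of _ inradius]) (simp add: dist_norm)
  with tendsto have "(F \<longlongrightarrow> F 0) (at 0)" unfolding F_0 by (rule Lim_transform_eventually)
  from doubly_periodic_entire_constant[OF doubly_periodic_holomorphic_extension[OF F_hol F_per this] F_per]
  have "F z = F 0" by (auto simp: constant_on_def)
  thus ?thesis using z_notin F_0 by (simp add: F_def)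
qed

theorem wp_ode:
  assumes "z \<notin> range w"
  shows "(wp' z)\<^sup>2 = 4 * wp z ^ 3 - 60 * G 4 * wp z - 140 * G 6"
proof -
  define f where "f z = (wp' z)\<^sup>2 - 4 * wp z ^ 3 + 60 * G 4 * wp z + 140 * G 6" for z
  obtain k where tendsto_k: "(k \<longlongrightarrow> 0) (at 0)"
    and wp_eq: "\<And>z. z \<noteq> 0 \<Longrightarrow> wp z = 1 / z\<^sup>2 + 3 * G 4 * z\<^sup>2 + 5 * G 6 * z ^ 4 + z ^ 4 * k z"
    using wp_expansion by blast
  obtain l where tendsto_l: "(l \<longlongrightarrow> 0) (at 0)"
    and wp'_eq: "\<And>z. z \<noteq> 0 \<Longrightarrow> wp' z = - 2 / z ^ 3 + 6 * G 4 * z + 20 * G 6 * z ^ 3 + z ^ 3 * l z"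
    using wp'_expansion by blast
  define y where "y z = 3 * G 4 * z + 5 * G 6 * z ^ 3 + z ^ 3 * k z" for z
  define v where "v z = 6 * G 4 * z + 20 * G 6 * z ^ 3 + z ^ 3 * l z" for z
  have tendsto_y: "(y \<longlongrightarrow> 0) (at 0)" and tendsto_v: "(v \<longlongrightarrow> 0) (at 0)"
    unfolding y_def v_def by (auto intro!: tendsto_eq_intros tendsto_k tendsto_l)
  have "((\<lambda>z. - 4 * l z - 12 * k z + (v z)\<^sup>2 - 12 * (y z)\<^sup>2 - 4 * (z * y z) ^ 3
      + 60 * G 4 * (z * y z)) \<longlongrightarrow> 0) (at 0)"
    by (rule tendsto_eq_intros tendsto_k tendsto_l tendsto_y tendsto_v refl)+ simp
  moreover have "- 4 * l z - 12 * k z + (v z)\<^sup>2 - 12 * (y z)\<^sup>2 - 4 * (z * y z) ^ 3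
      + 60 * G 4 * (z * y z) = f z" if "z \<noteq> 0" for z
  proof -
    have "wp z = 1 / z\<^sup>2 + z * y z" "wp' z = - 2 / z ^ 3 + v z"
      unfolding wp_eq[OF that] wp'_eq[OF that] y_def v_def
      by (simp_all add: power_numeral_reduce algebra_simps)
    thus ?thesis
      using weierstrass_ode_cancellation[OF that, of "G 4" "G 6" "l z" "k z"]
      by (simp add: f_def y_def v_def)
  qed
  ultimately have "(f \<longlongrightarrow> 0) (at 0)" by (rule LIM_cong[OF refl _ refl, THEN iffD1, rotated])
  hence "f z = 0"
  proof (rule doubly_periodic_constant[OF _ _ _ assms, rotated 2])
    show "f holomorphic_on - range w"
      unfolding f_def by (intro holomorphic_intros wp_holomorphic wp'_holomorphic)
    show "f (z + w q) = f z" if "z \<notin> range w" for z q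
      using that by (simp add: f_def wp'_add_period wp_add_period)
  qed
  thus ?thesis by (simp add: f_def algebra_simps)
qed

theorem wp_ode2:
  assumes "z \<notin> range w"
  shows "wp'' z = 6 * (wp z)\<^sup>2 - 30 * G 4"
proof -
  define f where "f z = wp'' z - 6 * (wp z)\<^sup>2" for z
  obtain k where tendsto_k: "(k \<longlongrightarrow> 0) (at 0)"
    and wp_eq: "\<And>z. z \<noteq> 0 \<Longrightarrow> wp z = 1 / z\<^sup>2 + 3 * G 4 * z\<^sup>2 + 5 * G 6 * z ^ 4 + z ^ 4 * k z"
    using wp_expansion by blast
  define y where "y z = 3 * G 4 + 5 * G 6 * z\<^sup>2 + z\<^sup>2 * k z" for z
  have tendsto_y: "(y \<longlongrightarrow> 3 * G 4) (at 0)"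
    unfolding y_def by (auto intro!: tendsto_eq_intros tendsto_k)
  have "isCont (regular_deriv 2) 0"
    using inradius_pos by (intro DERIV_isCont[OF DERIV_regular_deriv]) simp
  hence "(regular_deriv 2 \<longlongrightarrow> 6 * G 4) (at 0)"
    by (simp add: isCont_def regular_deriv_at_0 fact_numeral eval_nat_numeral)
  hence "((\<lambda>z. regular_deriv 2 z - 12 * y z - 6 * z ^ 4 * (y z)\<^sup>2) \<longlongrightarrow> - 30 * G 4) (at 0)"
    by (auto intro!: tendsto_eq_intros tendsto_y)
  moreover have "regular_deriv 2 z - 12 * y z - 6 * z ^ 4 * (y z)\<^sup>2 = f z" if "z \<noteq> 0" for z
  proof -
    have "wp z = 1 / z\<^sup>2 + z\<^sup>2 * y z"
      unfolding wp_eq[OF that] y_def by (simp add: power_numeral_reduce algebra_simps)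
    moreover have "(1 / z\<^sup>2 + z\<^sup>2 * y z)\<^sup>2 = 1 / z ^ 4 + 2 * y z + z ^ 4 * (y z)\<^sup>2"
      using that by (simp add: field_simps power_numeral_reduce)
    ultimately show ?thesis by (simp add: f_def wp''_split algebra_simps)
  qed
  ultimately have "(f \<longlongrightarrow> - 30 * G 4) (at 0)" by (rule LIM_cong[OF refl _ refl, THEN iffD1, rotated])
  hence "f z = - 30 * G 4"
  proof (rule doubly_periodic_constant[OF _ _ _ assms, rotated 2])
    show "f holomorphic_on - range w"
      unfolding f_def by (intro holomorphic_intros wp_holomorphic wp''_holomorphic)
    show "f (z + w q) = f z" if "z \<notin> range w" for z q
      using that by (simp add: f_def wp''_add_period wp_add_period)
  qed
  thus ?thesis by (simp add: f_def algebra_simps)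
qed

definition imag_wp :: "real \<Rightarrow> real" where "imag_wp u = - Re (wp (\<i> * of_real u))"

definition imag_wp' :: "real \<Rightarrow> real" where "imag_wp' u = Im (wp' (\<i> * of_real u))"

lemma wp_imag: "wp (\<i> * of_real u) = of_real (- imag_wp u)"
  using cnj_wp[of "\<i> * of_real u"] wp_uminus[of "\<i> * of_real u"]
  by (simp add: complex_eq_iff imag_wp_def)

lemma wp'_imag: "wp' (\<i> * of_real u) = \<i> * of_real (imag_wp' u)"
  using cnj_wp'[of "\<i> * of_real u"] wp'_uminus[of "\<i> * of_real u"]
  by (simp add: complex_eq_iff imag_wp'_def)

lemma imag_segment_notin_range_w:
  assumes "0 < u" "u \<le> b"
  shows "\<i> * of_real u \<notin> range w"
proof
  assume "\<i> * of_real u \<in> range w"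
  then obtain q where "\<i> * of_real u = w q" by blast
  hence "u = 2 * of_int (snd q) * b" by (simp add: complex_eq_iff)
  hence "0 < 2 * real_of_int (snd q) * b" "2 * real_of_int (snd q) * b \<le> 1 * b"
    using assms by simp_all
  hence "0 < real_of_int (snd q)" "2 * real_of_int (snd q) \<le> 1"
    using b_pos by (simp add: zero_less_mult_iff, simp only: mult_le_cancel_right_pos)
  hence "0 < snd q" "snd q < 1" by simp_all
  thus False by simp
qed

lemma DERIV_imag_wp:
  assumes "0 < u" "u \<le> b"
  shows "(imag_wp has_real_derivative imag_wp' u) (at u)"
  using DERIV_minus[OF DERIV_Re_along_imaginary[of wp _ 0]] DERIV_wp[OF imag_segment_notin_range_w[OF assms]]
  by (fastforce simp: imag_wp_def[abs_def] imag_wp'_def)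

lemma DERIV_imag_wp':
  assumes "0 < u" "u \<le> b"
  shows "(imag_wp' has_real_derivative 6 * (imag_wp u)\<^sup>2 - 30 * Re (G 4)) (at u)"
proof -
  note notin = imag_segment_notin_range_w[OF assms]
  have "(imag_wp' has_real_derivative Re (wp'' (\<i> * of_real u))) (at u)"
    using DERIV_Im_along_imaginary[of wp' _ 0] DERIV_wp'[OF notin] by (fastforce simp: imag_wp'_def[abs_def])
  also have "Re (wp'' (\<i> * of_real u)) = 6 * (imag_wp u)\<^sup>2 - 30 * Re (G 4)"
    by (simp add: wp_ode2[OF notin] wp_imag flip: of_real_power)
  finally show ?thesis .
qed

lemma imag_wp_ode:
  assumes "0 < u" "u \<le> b"
  shows "(imag_wp' u)\<^sup>2 = weierstrass_cubic (60 * Re (G 4)) (140 * Re (G 6)) (imag_wp u)"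
proof -
  have "(\<i> * of_real (imag_wp' u))\<^sup>2
      = 4 * of_real (- imag_wp u) ^ 3 - 60 * G 4 * of_real (- imag_wp u) - 140 * G 6"
    using wp_ode[OF imag_segment_notin_range_w[OF assms]] by (simp only: wp_imag wp'_imag)
  hence "Re (- of_real ((imag_wp' u)\<^sup>2))
      = Re (- of_real (4 * imag_wp u ^ 3) + 60 * G 4 * of_real (imag_wp u) - 140 * G 6)"
    by (simp add: power_mult_distrib power_minus_odd)
  thus ?thesis by (simp add: weierstrass_cubic_def)
qed

lemma filterlim_imag_wp: "filterlim imag_wp at_top (at_right 0)"
proof -
  have tendsto_0: "((\<lambda>u. \<i> * complex_of_real u) \<longlongrightarrow> 0) (at_right 0)"
    by (auto intro!: tendsto_eq_intros)
  have "isCont (regular_deriv 0) 0"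
    using inradius_pos by (intro DERIV_isCont[OF DERIV_regular_deriv]) simp
  hence "((\<lambda>u. - Re (regular_deriv 0 (\<i> * of_real u))) \<longlongrightarrow> - Re (regular_deriv 0 0)) (at_right 0)"
    by (intro tendsto_intros isCont_tendsto_compose[OF _ tendsto_0])
  moreover have "filterlim (\<lambda>u::real. inverse u ^ 2) at_top (at_right 0)"
    by (intro filterlim_pow_at_top filterlim_inverse_at_top_right) auto
  ultimately have "filterlim (\<lambda>u. - Re (regular_deriv 0 (\<i> * of_real u)) + inverse u ^ 2) at_top (at_right 0)"
    by (rule filterlim_tendsto_add_at_top)
  moreover have "- Re (regular_deriv 0 (\<i> * of_real u)) + inverse u ^ 2 = imag_wp u" for u
  proof -
    have "1 / (\<i> * complex_of_real u)\<^sup>2 = of_real (- (inverse u ^ 2))"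
      by (simp add: power_mult_distrib divide_inverse power_inverse)
    thus ?thesis by (simp only: imag_wp_def wp_split plus_complex.sel Re_complex_of_real)
  qed
  ultimately show ?thesis by simp
qed

lemma imag_wp'_end: "imag_wp' b = 0"
proof -
  have "\<i> * of_real b = w (0, 1) / 2" by (simp add: complex_eq_iff)
  thus ?thesis by (simp only: imag_wp'_def wp'_half_period zero_complex.sel)
qed

lemma weierstrass_real_branch_imag_wp:
  assumes "weierstrass_cubic (60 * Re (G 4)) (140 * Re (G 6)) r = 0" "0 < r" "60 * Re (G 4) < 12 * r\<^sup>2"
  shows "weierstrass_real_branch imag_wp imag_wp' (60 * Re (G 4)) (140 * Re (G 6)) r b"
proof
  show "(imag_wp' has_real_derivative 6 * (imag_wp u)\<^sup>2 - 60 * Re (G 4) / 2) (at u)" if "0 < u" "u \<le> b" for u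
    using DERIV_imag_wp'[OF that] by simp
qed (use assms in \<open>auto intro: b_pos DERIV_imag_wp imag_wp_ode filterlim_imag_wp imag_wp'_end\<close>)

theorem imaginary_half_period_eq_hyp2F1:
  fixes x :: real
  assumes x_bounds: "0 < x" "x < 1"
    and g2_eq: "60 * G 4 = of_real (trisection_g2 x)"
    and g3_eq: "140 * G 6 = of_real (trisection_g3 x)"
  shows "b = pi / (6 * sqrt 2) * hyp2F1 (1/3) (2/3) 1 x"
proof -
  have "60 * Re (G 4) = trisection_g2 x" "140 * Re (G 6) = trisection_g3 x"
    using arg_cong[OF g2_eq, of Re] arg_cong[OF g3_eq, of Re] by simp_all
  from weierstrass_real_branch_imag_wp[unfolded this, OF trisection_root_weierstrass[OF x_bounds]]
  interpret trisection_branch imag_wp imag_wp' x b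
    by (intro trisection_branch.intro trisection_branch_axioms.intro x_bounds)
  show ?thesis by (rule half_period_eq_hyp2F1)
qed

definition right_edge :: "real \<Rightarrow> complex" where
  "right_edge u = of_real a + \<i> * of_real u"

lemma right_edge_notin_range_w: "right_edge u \<notin> range w"
proof
  assume "right_edge u \<in> range w"
  then obtain q where "right_edge u = w q" by blast
  hence "a = 2 * of_int (fst q) * a" by (simp add: complex_eq_iff right_edge_def)
  hence "real_of_int (2 * fst q) = real_of_int 1" using a_pos by simp
  hence "2 * fst q = 1" by (simp only: of_int_eq_iff)
  thus False by presburger
qed

lemma cnj_right_edge: "cnj (right_edge u) = - right_edge u + w (1, 0)"
  by (simp add: complex_eq_iff right_edge_def)

lemma wp_right_edge: "wp (right_edge u) = of_real (Re (wp (right_edge u)))"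
proof -
  have notin: "- right_edge u \<notin> range w" by (subst uminus_in_range_w_iff) (rule right_edge_notin_range_w)
  show ?thesis
    using cnj_wp[of "right_edge u"] unfolding cnj_right_edge wp_add_period[OF notin] wp_uminus
    by (simp add: complex_eq_iff)
qed

lemma Re_wp'_right_edge: "Re (wp' (right_edge u)) = 0"
  using cnj_wp'[of "right_edge u"] unfolding cnj_right_edge wp'_add_period wp'_uminus
  by (simp add: complex_eq_iff)

lemma DERIV_Im_wp'_right_edge:
  "((\<lambda>u. Im (wp' (right_edge u))) has_real_derivative 6 * (Re (wp (right_edge u)))\<^sup>2 - 30 * Re (G 4)) (at u)"
proof -
  have "((\<lambda>u. Im (wp' (right_edge u))) has_real_derivative Re (wp'' (right_edge u))) (at u)"
    using DERIV_Im_along_imaginary[OF DERIV_wp'[OF right_edge_notin_range_w[unfolded right_edge_def]]]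
    by (simp only: right_edge_def)
  also have "Re (wp'' (right_edge u)) = 6 * (Re (wp (right_edge u)))\<^sup>2 - 30 * Re (G 4)"
    by (subst wp_ode2[OF right_edge_notin_range_w], subst wp_right_edge) (simp flip: of_real_power)
  finally show ?thesis .
qed

lemma wp'_not_identically_0: "\<exists>z. z \<notin> range w \<and> wp' z \<noteq> 0"
proof (rule ccontr)
  assume "\<nexists>z. z \<notin> range w \<and> wp' z \<noteq> 0"
  hence wp'_0: "wp' z = 0" if "z \<notin> range w" for z using that by blast
  have "z ^ 3 * regular_deriv 1 z = 2" if "z \<noteq> 0" "norm z < inradius" for z
    using wp'_0[OF near_0_notin_range_w, of z] that by (simp add: wp'_split field_simps)
  hence "\<forall>\<^sub>F z in at 0. z ^ 3 * regular_deriv 1 z = 2"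
    unfolding eventually_at using inradius_pos by (intro exI[of _ inradius]) (simp add: dist_norm)
  moreover have "isCont (\<lambda>z. z ^ 3 * regular_deriv 1 z) 0"
    using inradius_pos by (intro continuous_intros DERIV_isCont[OF DERIV_regular_deriv]) simp
  hence "((\<lambda>z. z ^ 3 * regular_deriv 1 z) \<longlongrightarrow> 0) (at 0)" by (simp add: isCont_def)
  ultimately have "((\<lambda>z::complex. 2) \<longlongrightarrow> (0 :: complex)) (at 0)"
    using Lim_transform_eventually by fastforce
  thus False by (simp add: tendsto_const_iff)
qed

text \<open>If \<open>g\<^sub>2 \<le> 0\<close>, then \<open>Im \<wp>'\<close> is monotone along the segment from \<open>a\<close> to \<open>a + ib\<close>. As both ends
  are half-periods, \<open>\<wp>'\<close> vanishes on the segment, hence everywhere.\<close>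

theorem Re_G4_pos: "0 < Re (G 4)"
proof (rule ccontr)
  assume not_pos: "\<not> 0 < Re (G 4)"
  have mono: "Im (wp' (right_edge u)) \<le> Im (wp' (right_edge v))" if "u \<le> v" for u v
  proof (rule DERIV_nonneg_imp_nondecreasing[OF that])
    fix t
    have "0 \<le> 6 * (Re (wp (right_edge t)))\<^sup>2 - 30 * Re (G 4)"
      using not_pos zero_le_power2[of "Re (wp (right_edge t))"] by linarith
    thus "\<exists>y. ((\<lambda>u. Im (wp' (right_edge u))) has_real_derivative y) (at t) \<and> 0 \<le> y"
      using DERIV_Im_wp'_right_edge by blast
  qed
  have "right_edge 0 = w (1, 0) / 2" "right_edge b = w (1, 1) / 2"
    by (simp_all add: complex_eq_iff right_edge_def)
  hence ends: "wp' (right_edge 0) = 0" "wp' (right_edge b) = 0" by (simp_all only: wp'_half_period)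
  have segment: "wp' (right_edge u) = 0" if "u \<in> {0..b}" for u
    using mono[of 0 u] mono[of u b] that ends Re_wp'_right_edge[of u] by (simp add: complex_eq_iff)
  have "right_edge 0 \<noteq> right_edge b" using b_pos by (simp add: complex_eq_iff right_edge_def)
  moreover have ends_in: "right_edge 0 \<in> right_edge ` {0..b}" "right_edge b \<in> right_edge ` {0..b}"
    using b_pos by auto
  ultimately have "right_edge ` {0..b} \<noteq> {z}" for z by (metis singletonD)
  moreover have "connected (right_edge ` {0..b})"
    unfolding right_edge_def by (intro connected_continuous_image continuous_intros) auto
  ultimately have islimpt: "right_edge 0 islimpt right_edge ` {0..b}"
    using ends_in by (intro connected_imp_perfect)
  have subset: "right_edge ` {0..b} \<subseteq> - range w"
    by (intro image_subsetI) (simp add: right_edge_notin_range_w)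
  have "wp' z = 0" if "z \<notin> range w" for z
    by (rule analytic_continuation[OF wp'_holomorphic open_complement_lattice
          connected_complement_lattice subset _ islimpt])
       (use that segment right_edge_notin_range_w in \<open>auto simp del: image_iff\<close>)
  thus False using wp'_not_identically_0 by blast
qed

end

section \<open>Values of the zeta function\<close>

lemma has_field_derivative_unique_on_open:
  fixes f g :: "'a :: real_normed_field \<Rightarrow> 'a"
  assumes "(f has_field_derivative D) (at x)" "(g has_field_derivative E) (at x)"
    and "open S" "x \<in> S" "\<And>y. y \<in> S \<Longrightarrow> f y = g y"
  shows "D = E"
  using has_field_derivative_transform_within_open[OF assms(1,3,4,5)] assms(2) DERIV_unique by blast

lemma Gamma_reflection_real:
  fixes x :: real
  shows "Gamma x * Gamma (1 - x) = pi / sin (pi * x)"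
proof -
  have "complex_of_real (Gamma x * Gamma (1 - x)) = complex_of_real (pi / sin (pi * x))"
    using Gamma_reflection_complex[of "complex_of_real x"]
    by (simp add: Gamma_complex_of_real[symmetric] sin_of_real[symmetric])
  thus ?thesis by (simp only: of_real_eq_iff)
qed

lemma unit_interval_notin_nonpos_Ints:
  fixes x :: real
  assumes "0 < x" "x < 1"
  shows "x \<notin> \<int>\<^sub>\<le>\<^sub>0" "1 - x \<notin> \<int>\<^sub>\<le>\<^sub>0"
  using assms by (auto dest: nonpos_Ints_nonpos)

lemma Digamma_reflection_real:
  fixes x :: real
  assumes x_bounds: "0 < x" "x < 1"
  shows "Digamma (1 - x) - Digamma x = pi * cot (pi * x)"
proof -
  note notin_nonpos_Ints = unit_interval_notin_nonpos_Ints[OF x_bounds]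
  have sin_pos: "0 < sin (pi * x)" using x_bounds by (intro sin_gt_zero) auto
  have "((\<lambda>x. Gamma (1 - x)) has_real_derivative - Gamma (1 - x) * Digamma (1 - x)) (at x)"
    using notin_nonpos_Ints by (auto intro!: derivative_eq_intros)
  hence "((\<lambda>x. Gamma x * Gamma (1 - x)) has_real_derivative
      Gamma x * Digamma x * Gamma (1 - x) + - Gamma (1 - x) * Digamma (1 - x) * Gamma x) (at x)"
    using notin_nonpos_Ints by (intro DERIV_mult has_field_derivative_Gamma) auto
  moreover have "((\<lambda>x. pi / sin (pi * x)) has_real_derivative
      - (pi / sin (pi * x)) * (pi * cot (pi * x))) (at x)"
    using sin_pos by (auto intro!: derivative_eq_intros simp: cot_def field_simps)
  ultimately have "Gamma x * Digamma x * Gamma (1 - x) + - Gamma (1 - x) * Digamma (1 - x) * Gamma x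
      = - (pi / sin (pi * x)) * (pi * cot (pi * x))"
    by (rule has_field_derivative_unique_on_open[OF _ _ open_UNIV UNIV_I Gamma_reflection_real])
  hence "(Gamma x * Gamma (1 - x)) * (Digamma (1 - x) - Digamma x) = pi / sin (pi * x) * (pi * cot (pi * x))"
    by (simp add: algebra_simps)
  thus ?thesis unfolding Gamma_reflection_real using sin_pos by simp
qed

text \<open>The iterated derivatives of the cotangent are polynomials in the cotangent, because
  \<open>cot' = - (1 + cot\<^sup>2)\<close>.\<close>

primrec cot_deriv_poly :: "nat \<Rightarrow> real poly" where
  "cot_deriv_poly 0 = [:0, 1:]"
| "cot_deriv_poly (Suc n) = - ([:1, 0, 1:] * pderiv (cot_deriv_poly n))"

lemma Polygamma_reflection_real:
  fixes x :: real
  assumes "0 < x" "x < 1"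
  shows "(-1) ^ n * Polygamma n (1 - x) - Polygamma n x = pi ^ Suc n * poly (cot_deriv_poly n) (cot (pi * x))"
  using assms
proof (induction n arbitrary: x)
  case 0
  thus ?case by (simp add: Digamma_reflection_real)
next
  case (Suc n)
  let ?P = "cot_deriv_poly n"
  note notin_nonpos_Ints = unit_interval_notin_nonpos_Ints[OF Suc.prems]
  have sin_pos: "0 < sin (pi * x)" using Suc.prems by (intro sin_gt_zero) auto
  have "((\<lambda>x. (-1) ^ n * Polygamma n (1 - x) - Polygamma n x) has_real_derivative
      (-1) ^ Suc n * Polygamma (Suc n) (1 - x) - Polygamma (Suc n) x) (at x)"
    using notin_nonpos_Ints by (auto intro!: derivative_eq_intros)
  moreover have "((\<lambda>x. pi ^ Suc n * poly ?P (cot (pi * x))) has_real_derivative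
      pi ^ Suc n * (poly (pderiv ?P) (cot (pi * x)) * (- inverse ((sin (pi * x))\<^sup>2) * pi))) (at x)"
    using sin_pos by (intro DERIV_cmult DERIV_chain2[OF poly_DERIV] DERIV_chain2[OF DERIV_cot])
      (auto intro!: derivative_eq_intros)
  ultimately have "(-1) ^ Suc n * Polygamma (Suc n) (1 - x) - Polygamma (Suc n) x
      = pi ^ Suc n * (poly (pderiv ?P) (cot (pi * x)) * (- inverse ((sin (pi * x))\<^sup>2) * pi))"
    by (rule has_field_derivative_unique_on_open[where S = "{0<..<1}"]) (use Suc in auto)
  also have "inverse ((sin (pi * x))\<^sup>2) = 1 + (cot (pi * x))\<^sup>2"
    using sin_pos sin_cos_squared_add[of "pi * x"] by (simp add: cot_def field_simps power_divide)
  also have "pi ^ Suc n * (poly (pderiv ?P) (cot (pi * x)) * (- (1 + (cot (pi * x))\<^sup>2) * pi))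
      = pi ^ Suc (Suc n) * poly (cot_deriv_poly (Suc n)) (cot (pi * x))"
    by (simp add: algebra_simps power2_eq_square)
  finally show ?case .
qed

lemma Polygamma_one_half:
  assumes "odd n"
  shows "Polygamma n (1/2 :: real) = - (pi ^ Suc n / 2 * poly (cot_deriv_poly n) 0)"
  using Polygamma_reflection_real[of "1/2" n] assms by (simp add: cot_def)

lemma zeta_sums_Polygamma_one_half:
  assumes n_odd: "0 < n" "odd n"
  shows "(\<lambda>k. 1 / real (Suc k) ^ Suc n) sums (Polygamma n (1/2) / (fact n * (2 ^ Suc n - 1)))"
proof -
  let ?f = "\<lambda>k. 1 / real (Suc k) ^ Suc n" and ?h = "Polygamma n (1/2) / fact n :: real"
  have "summable ?f"
    using Polygamma_converges'[of "1::real" "Suc n"] n_odd by (simp add: inverse_eq_divide del: power_Suc)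
  then obtain Z where sums_Z: "?f sums Z" by (auto simp: summable_def)
  have "summable (\<lambda>k. inverse ((1/2 + real k) ^ Suc n))"
    by (rule Polygamma_converges') (use n_odd in auto)
  hence sums_half: "(\<lambda>k. 1 / (1/2 + real k) ^ Suc n) sums ?h"
    using n_odd summable_sums by (fastforce simp: Polygamma_def inverse_eq_divide simp del: power_Suc)
  have sum_pair: "sum ?f {k * 2..<k * 2 + 2}
      = (1/2) ^ Suc n * (1 / (1/2 + real k) ^ Suc n) + (1/2) ^ Suc n * ?f k" for k
  proof -
    have scale: "(1/2) ^ Suc n * (1 / y ^ Suc n) = 1 / (2 * y) ^ Suc n" for y :: real
      by (simp add: power_mult_distrib power_divide del: power_Suc)
    have "{k * 2..<k * 2 + 2} = {2 * k, 2 * k + 1}" by auto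
    thus ?thesis unfolding scale by (simp add: algebra_simps del: power_Suc)
  qed
  have "(\<lambda>k. (1/2) ^ Suc n * (1 / (1/2 + real k) ^ Suc n) + (1/2) ^ Suc n * ?f k) sums Z"
    using sums_group[OF sums_Z, of 2] unfolding sum_pair by simp
  moreover have "(\<lambda>k. (1/2) ^ Suc n * (1 / (1/2 + real k) ^ Suc n) + (1/2) ^ Suc n * ?f k) sums
      ((1/2) ^ Suc n * ?h + (1/2) ^ Suc n * Z)"
    by (intro sums_add sums_mult sums_half sums_Z)
  ultimately have "Z = (1/2) ^ Suc n * ?h + (1/2) ^ Suc n * Z" by (rule sums_unique2)
  hence "2 ^ Suc n * Z = ?h + Z" by (simp add: power_divide field_simps del: power_Suc)
  hence "(2 ^ Suc n - 1) * Z = ?h" by (simp add: algebra_simps)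
  moreover have "(2::real) ^ Suc n - 1 \<noteq> 0" using one_less_power[of "2::real" "Suc n"] by linarith
  ultimately have "Z = ?h / (2 ^ Suc n - 1)" by (simp only: eq_divide_eq mult.commute) simp
  thus ?thesis using sums_Z by (simp only: divide_divide_eq_left)
qed

lemma zeta_4_sums: "(\<lambda>k. 1 / real (Suc k) ^ 4) sums (pi ^ 4 / 90)"
proof -
  have "poly (cot_deriv_poly 3) 0 = - 2" by (simp add: eval_nat_numeral pderiv_pCons)
  thus ?thesis
    using zeta_sums_Polygamma_one_half[of 3] by (simp add: Polygamma_one_half fact_numeral)
qed

lemma zeta_6_sums: "(\<lambda>k. 1 / real (Suc k) ^ 6) sums (pi ^ 6 / 945)"
proof -
  have "poly (cot_deriv_poly 5) 0 = - 16" by (simp add: eval_nat_numeral pderiv_pCons)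
  thus ?thesis
    using zeta_sums_Polygamma_one_half[of 5] by (simp add: Polygamma_one_half fact_numeral)
qed

section \<open>Existence of a rectangular lattice with given invariants\<close>

lemma norm_one_over_lattice_point_le:
  assumes "0 < a" "a \<le> a'" "0 < b" "b \<le> b'"
  shows "norm (1 / lattice_point a' b' q ^ k) \<le> 1 / norm (lattice_point a b q) ^ k"
proof (cases "q = 0")
  case True
  thus ?thesis by (simp add: norm_divide norm_power)
next
  case False
  have mono: "(2 * real_of_int n * c)\<^sup>2 \<le> (2 * real_of_int n * c')\<^sup>2" if "0 < c" "c \<le> c'" for n c c'
    unfolding power_mult_distrib using that by (intro mult_left_mono power_mono) auto
  have "norm (lattice_point a b q) \<le> norm (lattice_point a' b' q)"
    using assms by (simp add: cmod_def add_mono mono)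
  moreover have "0 < norm (lattice_point a b q)" using False assms by (simp add: lattice_point_eq_0_iff)
  ultimately show ?thesis
    by (auto simp: norm_divide norm_power intro!: divide_left_mono power_mono mult_pos_pos zero_less_power)
qed

lemma continuous_on_eisenstein_sum:
  assumes k_ge: "3 \<le> k" and a_pos: "0 < a"
  shows "continuous_on {0<..} (\<lambda>y. eisenstein_sum a y k)"
proof (intro continuous_at_imp_continuous_on ballI, unfold isCont_def eisenstein_sum_def,
    rule tendsto_infsum_dominated)
  fix y :: real assume "y \<in> {0<..}"
  hence y_pos: "0 < y" by simp
  interpret rect_lattice a "y / 2" using a_pos y_pos by unfold_locales auto
  show "(\<lambda>q. 1 / norm (lattice_point a (y / 2) q) ^ k) summable_on UNIV"
    using k_ge by (rule summable_norm_w)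
  show "norm (1 / lattice_point a v q ^ k) \<le> 1 / norm (lattice_point a (y / 2) q) ^ k"
    if "v \<in> {y / 2<..}" for q v
    using that a_pos y_pos by (intro norm_one_over_lattice_point_le) auto
  show "\<forall>\<^sub>F v in at y. v \<in> {y / 2<..}"
    using y_pos by (intro eventually_at_in_open') auto
  show "((\<lambda>v. 1 / lattice_point a v q ^ k) \<longlongrightarrow> 1 / lattice_point a y q ^ k) (at y)" for q
  proof (cases "q = 0")
    case False
    hence "lattice_point a y q \<noteq> 0" using a_pos y_pos by (simp add: lattice_point_eq_0_iff)
    thus ?thesis unfolding lattice_point_def by (intro tendsto_intros) auto
  qed simp
qed auto

lemma has_sum_int_even:
  fixes f :: "int \<Rightarrow> real"
  assumes "(\<lambda>n. f (int (Suc n))) sums s" and "\<And>n. 0 \<le> f n" and even: "\<And>n. f (- n) = f n" and "f 0 = 0"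
  shows "(f has_sum (2 * s)) UNIV"
proof -
  have has_sum_nat: "((\<lambda>n. f (int (Suc n))) has_sum s) UNIV"
    using assms by (intro sums_nonneg_imp_has_sum) auto
  have has_sum_pos: "(f has_sum s) {0<..}"
    by (rule has_sum_reindex_bij_witness[where i = "\<lambda>m. nat m - 1" and j = "\<lambda>n. int (Suc n)",
          THEN iffD1, OF _ _ _ _ _ _ has_sum_nat]) auto
  have has_sum_neg: "(f has_sum s) {..<0}"
    by (rule has_sum_reindex_bij_witness[where i = uminus and j = uminus,
          THEN iffD1, OF _ _ _ _ _ _ has_sum_pos]) (auto simp: even)
  have "(f has_sum (s + s)) ({0<..} \<union> {..<0})" by (rule has_sum_Un_disjoint[OF has_sum_pos has_sum_neg]) auto
  hence "(f has_sum (f 0 + (s + s))) (insert 0 ({0<..} \<union> {..<0}))" by (intro has_sum_insert) auto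
  also have "insert 0 ({0<..} \<union> {..<0}) = (UNIV :: int set)" by auto
  finally show ?thesis using assms(4) by simp
qed

lemma infsum_lattice_point_axis:
  assumes k_even: "even k" "0 < k" and sums_s: "(\<lambda>n. 1 / real (Suc n) ^ k) sums s"
  shows "(\<Sum>\<^sub>\<infinity>q. if snd q = 0 then 1 / lattice_point a b q ^ k else 0) = of_real (2 * s / (2 * a) ^ k)"
proof -
  have "((\<lambda>n::int. 1 / real_of_int n ^ k) has_sum (2 * s)) UNIV"
    using sums_s k_even by (intro has_sum_int_even) (auto simp: power_0_left add.commute)
  hence "((\<lambda>n::int. complex_of_real (1 / (2 * a) ^ k * (1 / real_of_int n ^ k))) has_sum
      of_real (1 / (2 * a) ^ k * (2 * s))) UNIV"
    by (intro has_sum_of_real has_sum_cmult_right)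
  moreover have "1 / lattice_point a b (n, 0) ^ k = complex_of_real (1 / (2 * a) ^ k * (1 / real_of_int n ^ k))" for n
  proof -
    have "lattice_point a b (n, 0) = of_real (2 * a * real_of_int n)" by (simp add: complex_eq_iff)
    thus ?thesis by (simp add: power_mult_distrib)
  qed
  ultimately have "((\<lambda>n. 1 / lattice_point a b (n, 0) ^ k) has_sum of_real (2 * s / (2 * a) ^ k)) UNIV"
    by simp
  hence "((\<lambda>q. 1 / lattice_point a b q ^ k) has_sum of_real (2 * s / (2 * a) ^ k)) {q. snd q = 0}"
    by (rule has_sum_reindex_bij_witness[where i = fst and j = "\<lambda>n. (n, 0)", THEN iffD1, rotated -1]) auto
  from infsumI[OF this] show ?thesis
    by (subst infsum_cong_neutral[where T = "{q. snd q = 0}" and g = "\<lambda>q. 1 / lattice_point a b q ^ k"]) auto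
qed

lemma tendsto_eisenstein_sum_at_top:
  assumes k_even: "even k" "3 \<le> k" and sums_s: "(\<lambda>n. 1 / real (Suc n) ^ k) sums s" and a_pos: "0 < a"
  shows "((\<lambda>y. eisenstein_sum a y k) \<longlongrightarrow> of_real (2 * s / (2 * a) ^ k)) at_top"
proof -
  interpret rect_lattice a 1 using a_pos by unfold_locales auto
  have "((\<lambda>y. eisenstein_sum a y k) \<longlongrightarrow> (\<Sum>\<^sub>\<infinity>q. if snd q = 0 then 1 / lattice_point a 1 q ^ k else 0)) at_top"
    unfolding eisenstein_sum_def
  proof (rule tendsto_infsum_dominated)
    show "(\<lambda>q. 1 / norm (lattice_point a 1 q) ^ k) summable_on UNIV"
      using k_even(2) by (rule summable_norm_w)
    show "norm (1 / lattice_point a y q ^ k) \<le> 1 / norm (lattice_point a 1 q) ^ k"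
      if "y \<in> {1..}" for q y
      using that a_pos by (intro norm_one_over_lattice_point_le) auto
    show "((\<lambda>y. 1 / lattice_point a y q ^ k) \<longlongrightarrow> (if snd q = 0 then 1 / lattice_point a 1 q ^ k else 0)) at_top" for q
    proof (cases "snd q = 0")
      case False
      have "filterlim (\<lambda>y. 2 * \<bar>real_of_int (snd q)\<bar> * y) at_top at_top"
        using False by (intro filterlim_tendsto_pos_mult_at_top[OF tendsto_const] filterlim_ident) auto
      moreover have "\<forall>\<^sub>F y in at_top. 2 * \<bar>real_of_int (snd q)\<bar> * y \<le> norm (lattice_point a y q)"
        using eventually_ge_at_top[of 0]
      proof eventually_elim
        case (elim y)
        thus ?case using abs_Im_le_cmod[of "lattice_point a y q"] by (simp add: abs_mult)
      qed
      ultimately have "filterlim (\<lambda>y. norm (lattice_point a y q)) at_top at_top"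
        by (rule filterlim_at_top_mono)
      hence "filterlim (\<lambda>y. lattice_point a y q ^ k) at_infinity at_top"
        using k_even(2) by (simp add: filterlim_at_infinity_conv_norm_at_top norm_power filterlim_pow_at_top)
      thus ?thesis using False by (auto intro: tendsto_divide_0[OF tendsto_const])
    qed (simp add: lattice_point_def)
  qed (auto simp: eventually_ge_at_top)
  thus ?thesis using k_even by (simp add: infsum_lattice_point_axis[OF _ _ sums_s])
qed

lemma eisenstein_sum_inverse:
  assumes "0 < y"
  shows "eisenstein_sum 1 (1 / y) k = (- \<i> * of_real y) ^ k * eisenstein_sum 1 y k"
proof -
  have "eisenstein_sum 1 (1 / y) k = eisenstein_sum (1 / y * y) (1 / y * 1) k" using assms by simp
  also have "\<dots> = of_real y ^ k * ((- \<i>) ^ k * eisenstein_sum 1 y k)"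
    unfolding eisenstein_sum_scale eisenstein_sum_swap[of y 1] by (simp add: power_divide)
  finally show ?thesis by (simp only: power_mult_distrib mult_ac)
qed

definition unit_g2 :: "real \<Rightarrow> real" where "unit_g2 y = 60 * Re (eisenstein_sum 1 y 4)"

definition unit_g3 :: "real \<Rightarrow> real" where "unit_g3 y = 140 * Re (eisenstein_sum 1 y 6)"

definition modular_ratio :: "real \<Rightarrow> real" where "modular_ratio y = unit_g3 y / sqrt (unit_g2 y) ^ 3"

lemma unit_g2_pos:
  assumes "0 < y"
  shows "0 < unit_g2 y"
proof -
  interpret rect_lattice 1 y using assms by unfold_locales auto
  show ?thesis using Re_G4_pos by (simp add: unit_g2_def)
qed

lemma modular_ratio_inverse:
  assumes y_pos: "0 < y"
  shows "modular_ratio (1 / y) = - modular_ratio y"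
proof -
  have "(- \<i>) ^ 4 = 1" "(- \<i>) ^ 6 = - 1" by (simp_all add: eval_nat_numeral)
  hence unit_g2_inverse: "unit_g2 (1 / y) = y ^ 4 * unit_g2 y" and unit_g3_inverse: "unit_g3 (1 / y) = - (y ^ 6 * unit_g3 y)"
    using y_pos by (simp_all only: unit_g2_def unit_g3_def eisenstein_sum_inverse power_mult_distrib)
       (simp_all flip: of_real_power)
  have "sqrt (unit_g2 (1 / y)) = sqrt ((y\<^sup>2)\<^sup>2 * unit_g2 y)" by (simp add: unit_g2_inverse flip: power_mult)
  also have "\<dots> = y\<^sup>2 * sqrt (unit_g2 y)" by (simp only: real_sqrt_mult real_sqrt_abs abs_power2)
  finally have "sqrt (unit_g2 (1 / y)) ^ 3 = y ^ 6 * sqrt (unit_g2 y) ^ 3"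
    by (simp add: power_mult_distrib flip: power_mult)
  thus ?thesis using y_pos by (simp add: modular_ratio_def unit_g3_inverse)
qed

lemma continuous_on_modular_ratio: "continuous_on {0<..} modular_ratio"
proof -
  have "continuous_on {0<..} unit_g2" "continuous_on {0<..} unit_g3"
    unfolding unit_g2_def unit_g3_def
    by (intro continuous_intros continuous_on_eisenstein_sum; simp)+
  thus ?thesis unfolding modular_ratio_def
    using unit_g2_pos by (intro continuous_intros) force+
qed

lemma sqrt_cubed_squared: "0 \<le> x \<Longrightarrow> (sqrt x ^ 3)\<^sup>2 = x ^ 3"
  by (subst power_mult[symmetric], subst mult.commute, subst power_mult) simp

lemma tendsto_modular_ratio: "(modular_ratio \<longlongrightarrow> 1 / sqrt 27) at_top"
proof -
  have "(unit_g2 \<longlongrightarrow> 60 * Re (of_real (2 * (pi ^ 4 / 90) / (2 * 1) ^ 4))) at_top"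
    unfolding unit_g2_def by (intro tendsto_intros tendsto_eisenstein_sum_at_top zeta_4_sums) auto
  moreover have "(unit_g3 \<longlongrightarrow> 140 * Re (of_real (2 * (pi ^ 6 / 945) / (2 * 1) ^ 6))) at_top"
    unfolding unit_g3_def by (intro tendsto_intros tendsto_eisenstein_sum_at_top zeta_6_sums) auto
  ultimately have "(unit_g2 \<longlongrightarrow> pi ^ 4 / 12) at_top" "(unit_g3 \<longlongrightarrow> pi ^ 6 / 216) at_top"
    by simp_all
  hence tendsto_quotient: "(modular_ratio \<longlongrightarrow> (pi ^ 6 / 216) / sqrt (pi ^ 4 / 12) ^ 3) at_top"
    unfolding modular_ratio_def by (intro tendsto_intros) auto
  have "(sqrt (pi ^ 4 / 12) ^ 3)\<^sup>2 = (pi ^ 4 / 12) ^ 3" by (rule sqrt_cubed_squared) simp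
  hence "((pi ^ 6 / 216) / sqrt (pi ^ 4 / 12) ^ 3)\<^sup>2 = (pi ^ 6 / 216)\<^sup>2 / (pi ^ 4 / 12) ^ 3"
    by (simp only: power_divide[of _ "sqrt _ ^ 3"])
  also have "\<dots> = 1 / 27" by (simp add: power_divide flip: power_mult)
  finally have "((pi ^ 6 / 216) / sqrt (pi ^ 4 / 12) ^ 3)\<^sup>2 = 1 / 27" .
  hence "sqrt (1 / 27) = (pi ^ 6 / 216) / sqrt (pi ^ 4 / 12) ^ 3" by (rule real_sqrt_unique) simp
  with tendsto_quotient show ?thesis by (simp add: real_sqrt_divide)
qed

lemma modular_ratio_surj:
  assumes \<rho>: "\<bar>\<rho>\<bar> < 1 / sqrt 27"
  obtains y where "0 < y" "modular_ratio y = \<rho>"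
proof -
  have "\<forall>\<^sub>F y in at_top. \<bar>\<rho>\<bar> < modular_ratio y \<and> 1 \<le> y"
    using order_tendstoD(1)[OF tendsto_modular_ratio \<rho>] eventually_ge_at_top by (rule eventually_conj)
  then obtain Y where Y_bounds: "\<bar>\<rho>\<bar> < modular_ratio Y" "1 \<le> Y" by (auto simp: eventually_at_top_linorder)
  have "\<exists>y\<ge>1 / Y. y \<le> Y \<and> modular_ratio y = \<rho>"
  proof (rule IVT')
    show "modular_ratio (1 / Y) \<le> \<rho>" using modular_ratio_inverse[of Y] Y_bounds by simp
    show "1 / Y \<le> Y" using Y_bounds by (intro order_trans[of "1 / Y" 1 Y]) auto
    show "continuous_on {1 / Y..Y} modular_ratio"
      by (rule continuous_on_subset[OF continuous_on_modular_ratio])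
         (use Y_bounds in \<open>auto intro: less_le_trans[of 0 "1 / Y"]\<close>)
  qed (use Y_bounds in auto)
  then obtain y where y_root: "1 / Y \<le> y" "modular_ratio y = \<rho>" by blast
  have "0 < 1 / Y" using Y_bounds by simp
  with y_root(1) have "0 < y" by linarith
  thus thesis using y_root(2) by (rule that)
qed

theorem rectangular_lattice_exists:
  fixes g2 g3 :: real
  assumes g2_pos: "0 < g2" and discriminant: "27 * g3\<^sup>2 < g2 ^ 3"
  obtains a b where "0 < a" "0 < b" "lattice_g2 (of_real a) (\<i> * of_real b) = of_real g2"
    "lattice_g3 (of_real a) (\<i> * of_real b) = of_real g3"
proof -
  have "(g3 / sqrt g2 ^ 3)\<^sup>2 = g3\<^sup>2 / g2 ^ 3"
    using g2_pos by (simp only: power_divide sqrt_cubed_squared less_imp_le)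
  also have "\<dots> < (1 / sqrt 27)\<^sup>2" using discriminant g2_pos by (simp add: power_divide field_simps)
  finally have "\<bar>g3 / sqrt g2 ^ 3\<bar>\<^sup>2 < (1 / sqrt 27)\<^sup>2" by (simp only: power2_abs)
  hence "\<bar>g3 / sqrt g2 ^ 3\<bar> < 1 / sqrt 27" by (rule power2_less_imp_less) simp
  then obtain y where y_root: "0 < y" "modular_ratio y = g3 / sqrt g2 ^ 3" by (rule modular_ratio_surj)
  define c where "c = sqrt (sqrt (unit_g2 y / g2))"
  have c_pos: "0 < unit_g2 y" "0 < c" using unit_g2_pos[OF y_root(1)] g2_pos by (simp_all add: c_def)
  have c_squared: "c\<^sup>2 = sqrt (unit_g2 y) / sqrt g2"
    using c_pos(1) g2_pos unfolding c_def by (subst real_sqrt_pow2) (simp_all add: real_sqrt_divide)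
  have "c ^ 4 = (c\<^sup>2)\<^sup>2" by (simp flip: power_mult)
  also have "\<dots> = unit_g2 y / g2" unfolding c_squared using c_pos(1) g2_pos by (simp add: power_divide)
  finally have "unit_g2 y / c ^ 4 = g2" using c_pos(1) by simp
  moreover have "c ^ 6 = (c\<^sup>2) ^ 3" by (simp flip: power_mult)
  hence c_power_6: "c ^ 6 = sqrt (unit_g2 y) ^ 3 / sqrt g2 ^ 3" by (simp add: c_squared power_divide)
  have "unit_g3 y / c ^ 6 = g3"
    using y_root(2) c_pos(1) g2_pos by (simp add: c_power_6 modular_ratio_def field_simps)
  moreover have "60 * eisenstein_sum (c * 1) (c * y) 4 = of_real (unit_g2 y / c ^ 4)"
    "140 * eisenstein_sum (c * 1) (c * y) 6 = of_real (unit_g3 y / c ^ 6)"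
    unfolding eisenstein_sum_scale by (simp_all add: unit_g2_def unit_g3_def of_real_Re_eisenstein_sum)
  ultimately show thesis
    using c_pos(2) y_root(1) by (intro that[of c "c * y"]) (simp_all add: lattice_g2_eq lattice_g3_eq del: of_real_mult)
qed

section \<open>The imaginary half-period\<close>

lemma imaginary_half_period_unique:
  fixes \<Omega> x :: real and \<Omega>' :: complex
  assumes x_bounds: "0 < x" "x < 1" and \<Omega>_pos: "0 < \<Omega>" and \<Omega>'_imag: "Re \<Omega>' = 0" "0 < Im \<Omega>'"
    and g2_eq: "lattice_g2 (of_real \<Omega>) \<Omega>' = of_real (trisection_g2 x)"
    and g3_eq: "lattice_g3 (of_real \<Omega>) \<Omega>' = of_real (trisection_g3 x)"
  shows "\<Omega>' = \<i> * of_real (1 / (6 * sqrt 2) * pi * hyp2F1 (1/3) (2/3) 1 x)"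
proof -
  interpret rect_lattice \<Omega> "Im \<Omega>'" using \<Omega>_pos \<Omega>'_imag by unfold_locales
  have \<Omega>'_eq: "\<Omega>' = \<i> * of_real (Im \<Omega>')" using \<Omega>'_imag by (simp add: complex_eq_iff)
  have "Im \<Omega>' = pi / (6 * sqrt 2) * hyp2F1 (1/3) (2/3) 1 x"
    using g2_eq g3_eq unfolding lattice_g2_eq[of _ "Im \<Omega>'", folded \<Omega>'_eq] lattice_g3_eq[of _ "Im \<Omega>'", folded \<Omega>'_eq]
    by (rule imaginary_half_period_eq_hyp2F1[OF x_bounds])
  thus ?thesis by (subst \<Omega>'_eq) simp
qed

theorem theorem9:
  fixes \<kappa> :: real
  assumes "0 < \<kappa>" and "\<kappa> < 1"
  defines "lam \<equiv> sqrt (1 - \<kappa>^2)"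
    and "G2 \<equiv> 48 * (1 + 8 * \<kappa>^2)"
    and "G3 \<equiv> 64 * (1 - 20 * \<kappa>^2 - 8 * \<kappa>^4)"
  shows "(\<exists>\<Omega> t :: real. 0 < \<Omega> \<and> 0 < t \<and>
            lattice_g2 (complex_of_real \<Omega>) (\<i> * complex_of_real t) = complex_of_real G2 \<and>
            lattice_g3 (complex_of_real \<Omega>) (\<i> * complex_of_real t) = complex_of_real G3)
       \<and> (\<forall>(\<Omega>::real) (\<Omega>'::complex). 0 < \<Omega> \<and> Re \<Omega>' = 0 \<and> 0 < Im \<Omega>' \<and>
            lattice_g2 (complex_of_real \<Omega>) \<Omega>' = complex_of_real G2 \<and>
            lattice_g3 (complex_of_real \<Omega>) \<Omega>' = complex_of_real G3 \<longrightarrow>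
            \<Omega>' = \<i> * complex_of_real (1 / (6 * sqrt 2) * pi * hyp2F1 (1/3) (2/3) 1 (lam^2)))"
proof -
  have \<kappa>2: "0 < \<kappa>\<^sup>2" "\<kappa>\<^sup>2 < 1" using assms(1,2) by (simp_all add: power_less_one_iff)
  have \<kappa>4: "\<kappa> ^ 4 = (\<kappa>\<^sup>2)\<^sup>2" by (simp flip: power_mult)
  have "G2 ^ 3 - 27 * G3\<^sup>2 = 7077888 * \<kappa>\<^sup>2 * (1 - \<kappa>\<^sup>2) ^ 3"
    unfolding G2_def G3_def \<kappa>4 by (simp add: algebra_simps power2_eq_square power3_eq_cube)
  also have "\<dots> > 0" using \<kappa>2 by simp
  finally have "27 * G3\<^sup>2 < G2 ^ 3" by simp
  moreover have "0 < G2" by (simp add: G2_def add_pos_nonneg)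
  ultimately have "\<exists>\<Omega> t. 0 < \<Omega> \<and> 0 < t \<and>
      lattice_g2 (of_real \<Omega>) (\<i> * of_real t) = of_real G2 \<and>
      lattice_g3 (of_real \<Omega>) (\<i> * of_real t) = of_real G3"
    using rectangular_lattice_exists by metis
  moreover have lam2: "lam\<^sup>2 = 1 - \<kappa>\<^sup>2" using \<kappa>2 by (simp add: lam_def)
  have lam: "0 < lam\<^sup>2" "lam\<^sup>2 < 1" using \<kappa>2 by (simp_all add: lam2)
  have "G2 = trisection_g2 (lam\<^sup>2)" "G3 = trisection_g3 (lam\<^sup>2)"
    unfolding G2_def G3_def lam2 \<kappa>4 trisection_g2_def trisection_g3_def
    by (simp_all add: algebra_simps power2_eq_square)
  ultimately show ?thesis using imaginary_half_period_unique[OF lam] by metis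
qed

end
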